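(* Let $b$ be a prime, let $s,m,\alpha,d\in\mathbb{N}$ with $1<d\le\alpha$, and let $\boldsymbol{\gamma}=(\gamma_v)_{v\subseteq\{1:s\}}$ be non-negative real weights. Suppose $p\in\mathbb{F}_b[x]$ and $\boldsymbol{q}=(q_1,\ldots,q_{ds})$ are found by the component-by-component algorithm: $p$ is an irreducible polynomial with $\deg(p)=m$, $q_1=1$, and for $\tau=2,\ldots,ds$ successively, $q_\tau$ minimizes $B_{d,\boldsymbol{\gamma},(2)}((q_1,\ldots,q_{\tau-1},\tilde q_\tau),p)$ as a function of $\tilde q_\tau\in\mathcal{R}_m$. Write $\boldsymbol{q}_\tau=(q_1,\ldots,q_\tau)$. Then for any $\tau=1,\ldots,ds$ and any real $\lambda$ with $1/\min(\alpha,d)<\lambda\le1$ we have $$B_{d,\boldsymbol{\gamma},(2)}(\boldsymbol{q}_\tau,p)\le\frac1{(b^m-1)^{1/\lambda}}\left[\sum_{\emptyset\ne v\subseteq\{1:j_0-1\}}\gamma_v^\lambda G_{d,\lambda,d,(2)}^{|v|}+G_{d,\lambda,d_0,(2)}\sum_{v\subseteq\{1:j_0-1\}}\gamma_{v\cup\{j_0\}}^\lambda G_{d,\lambda,d,(2)}^{|v|}\right]^{1/\lambda},$$ where $j_0=\lceil\tau/d\rceil$, $d_0=\tau-(j_0-1)d$, and for $a=1,\ldots,d$ $$G_{d,\lambda,a,(2)}=-1+\prod_{l=1}^a\left[1+b^{\lambda(d-l)}\tilde G_{d,\lambda,(2)}\right],\qquad\tilde G_{d,\lambda,(2)}=\m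ax\left\{\left(\frac{b-1}{b^{\min(\alpha,d)}-b}\right)^\lambda,\frac{b-1}{b^{\lambda\min(\alpha,d)}-b}\right\}.$$
   Context: $\{a:c\}=\{a,a+1,\ldots,c\}$ (empty if $c<a$). $\mathbb{F}_b$ is the field with $b$ elements, identified with $\{0,\ldots,b-1\}$. $\mathcal{R}_m=\{q\in\mathbb{F}_b[x]:\deg(q)<m,\ q\ne0\}$. A non-negative integer $n=\nu_0+\nu_1b+\cdots$ is identified with the polynomial $n(x)=\nu_0+\nu_1x+\cdots\in\mathbb{F}_b[x]$. $v_m(\sum_{l=w}^\infty t_lx^{-l})=\sum_{l=\max(1,w)}^mt_lb^{-l}$ for formal Laurent series over $\mathbb{F}_b$, and for a generating vector $(q_1,q_2,\ldots)$ and modulus $p$ with $\deg(p)=m$, $z_{n,j}=v_m(n(x)q_j(x)/p(x))\in[0,1)$ for $0\le n<b^m$. For $z\in[0,1)$, $$\phi_{d,(2)}(z)=\frac{b^{d-1}\left(b-1-b^{(d-1)\lfloor\log_bz\rfloor}(b^d-1)\right)}{b^{d-1}-1},$$ where for $z=0$ one sets $b^{\lfloor\log_b0\rfloor}=0$. For $1\le\tau\le ds$, $j_0=\lceil\tau/d\rceil$, $d_0=\tau-(j_0-1)d$, and $\boldsymbol{q}_\tau=(q_1,\ldots,q_\tau)$, $$B_{d,\boldsymbol{\gamma},(2)}(\boldsymbol{q}_\tau,p)=\frac1{b^m}\sum_{n=0}^{b^m-1}\sum_{\emptyset\ne v\subseteq\{1:j_0-1\}}\gamma_v\prod_{j\in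 v}\Psi_{n,j}+\frac1{b^m}\sum_{n=0}^{b^m-1}\sum_{v\subseteq\{1:j_0-1\}}\gamma_{v\cup\{j_0\}}\Big(\prod_{j\in v}\Psi_{n,j}\Big)\left[-1+\prod_{l=1}^{d_0}\left(1+\frac{\phi_{d,(2)}(z_{n,(j_0-1)d+l})}{b^l}\right)\right],$$ where $\Psi_{n,j}=-1+\prod_{l=1}^d\left(1+b^{-l}\phi_{d,(2)}(z_{n,(j-1)d+l})\right)$. (For $\tau=ds$ this quantity is, for $d\le\alpha$, an upper bound on the worst-case integration error, in the weighted Walsh space of smoothness $\alpha$ with weights $\boldsymbol{\gamma}$, of the interlaced polynomial lattice rule of order $d$ with generating vector $\boldsymbol{q}$ and modulus $p$.) *)

theory Defs
  imports
    "HOL-Analysis.Analysis"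
    "HOL-Computational_Algebra.Formal_Laurent_Series"
    "Berlekamp_Zassenhaus.Finite_Field"
begin

text \<open>
  Throughout, the prime \<open>b\<close> is the cardinality of a type \<open>'f\<close> of class \<open>prime_card\<close>, and
  the field with \<open>b\<close> elements is \<open>'f mod_ring\<close>, whose representatives are \<open>{0..<b}\<close>.
\<close>

definition nat_poly :: "nat \<Rightarrow> 'f::prime_card mod_ring poly" where
  "nat_poly n = (\<Sum>i\<le>n. Polynomial.monom (of_nat (n div CARD('f) ^ i mod CARD('f))) i)"
  \<comment> \<open>all base-\<open>b\<close> digits of \<open>n\<close> at positions above \<open>n\<close> vanish\<close>

text \<open>
  A series in \<open>x\<^sup>-\<^sup>1\<close> is represented by a formal Laurent series whose variable \<open>fls_X\<close> stands for
  \<open>x\<^sup>-\<^sup>1\<close>; so \<open>x\<close> itself is \<open>fls_X_inv\<close>, and the coefficient of \<open>x\<^sup>-\<^sup>l\<close> in \<open>f\<close> is \<open>fls_nth f l\<close>.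
\<close>

definition laurent_of_poly :: "'a::field poly \<Rightarrow> 'a fls" where
  "laurent_of_poly f = (\<Sum>i\<le>Polynomial.degree f. fls_const (Polynomial.coeff f i) * fls_X_inv ^ i)"

definition v_trunc :: "nat \<Rightarrow> 'f::prime_card mod_ring fls \<Rightarrow> real" where
  "v_trunc m f = (\<Sum>l = 1..m. real_of_int (to_int_mod_ring (fls_nth f (int l))) / real CARD('f) ^ l)"
  \<comment> \<open>coefficients below the order of \<open>f\<close> are zero, so the sum may start at \<open>l = 1\<close>\<close>

definition lattice_pt ::
  "'f::prime_card mod_ring poly \<Rightarrow> (nat \<Rightarrow> 'f mod_ring poly) \<Rightarrow> nat \<Rightarrow> nat \<Rightarrow> real" where
  "lattice_pt p q n j =
     v_trunc (Polynomial.degree p) (laurent_of_poly (nat_poly n) * laurent_of_poly (q j) / laurent_of_poly p)"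

definition \<phi>2 :: "nat \<Rightarrow> nat \<Rightarrow> real \<Rightarrow> real" where
  "\<phi>2 b d z =
     real b ^ (d - 1)
       * (real b - 1
          - (if z = 0 then 0 else real b powi (int (d - 1) * \<lfloor>log (real b) z\<rfloor>)) * (real b ^ d - 1))
     / (real b ^ (d - 1) - 1)"

text \<open>
  Below, \<open>block_term p d q n j a\<close> is \<open>-1 + \<Prod>\<^sub>l (1 + b\<^sup>-\<^sup>l \<phi>(z))\<close> over the first \<open>a\<close> of the \<open>d\<close>
  components that are interlaced into coordinate \<open>j\<close>; the full block \<open>a = d\<close> is \<open>\<Psi>\<close>.
\<close>

definition block_term ::
  "'f::prime_card mod_ring poly \<Rightarrow> nat \<Rightarrow> (nat \<Rightarrow> 'f mod_ring poly) \<Rightarrow> nat \<Rightarrow> nat \<Rightarrow> nat \<Rightarrow> real" where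
  "block_term p d q n j a =
     - 1 + (\<Prod>l = 1..a. 1 + \<phi>2 CARD('f) d (lattice_pt p q n ((j - 1) * d + l)) / real CARD('f) ^ l)"

abbreviation \<Psi> ::
  "'f::prime_card mod_ring poly \<Rightarrow> nat \<Rightarrow> (nat \<Rightarrow> 'f mod_ring poly) \<Rightarrow> nat \<Rightarrow> nat \<Rightarrow> real" where
  "\<Psi> p d q n j \<equiv> block_term p d q n j d"

definition j0 :: "nat \<Rightarrow> nat \<Rightarrow> nat" where
  "j0 d \<tau> = nat \<lceil>real \<tau> / real d\<rceil>"

definition d0 :: "nat \<Rightarrow> nat \<Rightarrow> nat" where
  "d0 d \<tau> = \<tau> - (j0 d \<tau> - 1) * d"

text \<open>
  A generating vector \<open>(q\<^sub>1, q\<^sub>2, \<dots>)\<close> is a function on \<open>nat\<close> of which only indices from \<open>1\<close> on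
  matter; \<open>B2 d \<gamma> p q \<tau>\<close> depends only on \<open>q 1, \<dots>, q \<tau>\<close>.
\<close>

definition B2 ::
  "nat \<Rightarrow> (nat set \<Rightarrow> real) \<Rightarrow> 'f::prime_card mod_ring poly \<Rightarrow> (nat \<Rightarrow> 'f mod_ring poly) \<Rightarrow> nat \<Rightarrow> real" where
  "B2 d \<gamma> p q \<tau> =
     (1 / real CARD('f) ^ Polynomial.degree p) *
       (\<Sum>n<CARD('f) ^ Polynomial.degree p.
          \<Sum>v | v \<subseteq> {1..j0 d \<tau> - 1} \<and> v \<noteq> {}. \<gamma> v * (\<Prod>j\<in>v. \<Psi> p d q n j))
   + (1 / real CARD('f) ^ Polynomial.degree p) *
       (\<Sum>n<CARD('f) ^ Polynomial.degree p.
          \<Sum>v | v \<subseteq> {1..j0 d \<tau> - 1}.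
            \<gamma> (v \<union> {j0 d \<tau>}) * (\<Prod>j\<in>v. \<Psi> p d q n j) * block_term p d q n (j0 d \<tau>) (d0 d \<tau>))"

definition nonzero_polys_below :: "nat \<Rightarrow> 'a::zero poly set" where
  "nonzero_polys_below m = {q. Polynomial.degree q < m \<and> q \<noteq> 0}"

text \<open>
  The possible outputs of the component-by-component algorithm: minimizers need not be unique, so
  this is a predicate.
\<close>

definition cbc_output ::
  "nat \<Rightarrow> nat \<Rightarrow> nat \<Rightarrow> (nat set \<Rightarrow> real) \<Rightarrow> 'f::prime_card mod_ring poly \<Rightarrow> (nat \<Rightarrow> 'f mod_ring poly) \<Rightarrow> bool" where
  "cbc_output s m d \<gamma> p q \<longleftrightarrow>
     Factorial_Ring.irreducible p \<and> Polynomial.degree p = m \<and> q 1 = 1 \<and>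
     (\<forall>\<tau>\<in>{2..d * s}. q \<tau> \<in> nonzero_polys_below m \<and>
        (\<forall>r \<in> nonzero_polys_below m. B2 d \<gamma> p q \<tau> \<le> B2 d \<gamma> p (q(\<tau> := r)) \<tau>))"

definition G2_tilde :: "nat \<Rightarrow> nat \<Rightarrow> nat \<Rightarrow> real \<Rightarrow> real" where
  "G2_tilde b \<alpha> d lam =
     max (((real b - 1) / (real b ^ min \<alpha> d - real b)) powr lam)
         ((real b - 1) / (real b powr (lam * real (min \<alpha> d)) - real b))"

definition G2 :: "nat \<Rightarrow> nat \<Rightarrow> nat \<Rightarrow> real \<Rightarrow> nat \<Rightarrow> real" where
  "G2 b \<alpha> d lam a =
     - 1 + (\<Prod>l = 1..a. 1 + real b powr (lam * (real d - real l)) * G2_tilde b \<alpha> d lam)"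

end

theory Submission
  imports Defs "HOL-Library.Real_Mod"
begin

text \<open>
  Everything is carried out on the finite group of polynomials of degree below \<open>m\<close>, with the additive
  characters \<open>h \<mapsto> \<chi>(k h mod p)\<close>. On the lattice points the Walsh series of \<open>\<phi>\<close> folds into a finite
  expansion \<open>\<phi>(v\<^sub>m(f / p)) = \<Sum>\<^sub>k c\<^sub>k \<chi>(k f mod p)\<close> with \<open>c\<^sub>k \<ge> 0\<close>, for which both
  \<open>\<Sum>\<^sub>k c\<^sub>k powr \<lambda>\<close> and \<open>(b\<^sup>m - 1) c\<^sub>0 powr \<lambda>\<close> are at most \<open>M = b powr (\<lambda> d) * G2_tilde\<close>; the two terms of
  the maximum in \<open>G2_tilde\<close> control the folded tail and the coefficients proper.

  Adding component \<open>\<tau>\<close> increases \<open>B\<close> by a multiple of the mean over \<open>h\<close> of \<open>W(h) \<phi>(v\<^sub>m(h q\<^sub>\<tau> / p))\<close>, where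
  \<open>W\<close> has nonnegative Fourier coefficients \<open>w\<close>. By Parseval this is \<open>\<Sum>\<^sub>k c\<^sub>k w(-k q\<^sub>\<tau> mod p)\<close>. Summing
  \<open>\<lambda>\<close>-th powers over all nonzero candidates, each \<open>k \<noteq> 0\<close> permutes the nonzero residues since \<open>p\<close> is
  irreducible, so the sum is at most \<open>M \<Sum>\<^sub>k w(k) powr \<lambda>\<close>, and a minimizer satisfies this bound divided by
  \<open>b\<^sup>m - 1\<close>. The \<open>\<lambda>\<close>-th power sums of spectra are subadditive and submultiplicative, and the resulting
  bounds on the increments telescope to the claim.
\<close>

subsection \<open>Subadditivity of powers\<close>

text \<open>Scaling by \<open>x + y\<close> reduces the claim to \<open>t \<le> t powr lam\<close>
  on the unit interval.\<close>

lemma powr_add_le: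
  fixes x y lam :: real
  assumes "x \<ge> 0" "y \<ge> 0" "0 < lam" "lam \<le> 1"
  shows "(x + y) powr lam \<le> x powr lam + y powr lam"
proof (cases "x + y = 0")
  case True
  then show ?thesis using assms by simp
next
  case False
  define s where "s = x + y"
  have s: "s > 0" using False assms by (simp add: s_def)
  have le: "t \<le> t powr lam" if "0 \<le> t" "t \<le> 1" for t :: real
    using powr_mono'[OF \<open>lam \<le> 1\<close>, of t] that by (cases "t = 0") auto
  have "1 = x / s + y / s"
    using s by (simp add: s_def add_divide_distrib[symmetric])
  also have "\<dots> \<le> (x / s) powr lam + (y / s) powr lam"
    using assms s by (intro add_mono le) (auto simp: s_def)
  also have "\<dots> = (x powr lam + y powr lam) / s powr lam"
    using assms s by (simp add: powr_divide add_divide_distrib)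
  finally show ?thesis using s by (simp add: field_simps s_def)
qed

lemma powr_sum_le:
  fixes f :: "'a \<Rightarrow> real" and lam :: real
  assumes "\<And>i. i \<in> A \<Longrightarrow> f i \<ge> 0" "0 < lam" "lam \<le> 1"
  shows "(\<Sum>i\<in>A. f i) powr lam \<le> (\<Sum>i\<in>A. f i powr lam)"
  using assms(1)
proof (induction A rule: infinite_finite_induct)
  case (insert x A)
  have "(f x + sum f A) powr lam \<le> f x powr lam + sum f A powr lam"
    using insert assms by (intro powr_add_le sum_nonneg) auto
  with insert show ?case by fastforce
qed auto

subsection \<open>Polynomials of bounded degree\<close>

text \<open>Stated through coefficients so that the zero polynomial belongs to every
  \<open>low a\<close>, even to \<open>low 0\<close>; over a ring each \<open>low a\<close> is then
  an additive group.\<close>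

definition low :: "nat \<Rightarrow> 'a::zero poly set" where
  "low a = {f. \<forall>i\<ge>a. Polynomial.coeff f i = 0}"

lemma low_iff: "f \<in> low a \<longleftrightarrow> f = 0 \<or> Polynomial.degree f < a"
proof
  assume "f \<in> low a"
  then show "f = 0 \<or> Polynomial.degree f < a"
    unfolding low_def using leading_coeff_0_iff not_less by blast
qed (auto simp: low_def coeff_eq_0)

lemma low_zero [simp]: "0 \<in> low a"
  by (simp add: low_def)

lemma low_0 [simp]: "low 0 = {0}"
  by (auto simp: low_iff)

lemma low_add: "f \<in> low a \<Longrightarrow> g \<in> low a \<Longrightarrow> f + g \<in> low a"
  for f g :: "'a::comm_monoid_add poly"
  by (simp add: low_def)

lemma low_mono: "a \<le> a' \<Longrightarrow> low a \<subseteq> low a'"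
  by (auto simp: low_def)

lemma low_mod: "p \<noteq> 0 \<Longrightarrow> f mod p \<in> low (Polynomial.degree p)"
  for f p :: "'a::field poly"
  using degree_mod_less[of p f] by (simp add: low_iff)

lemma mod_low: "f \<in> low (Polynomial.degree p) \<Longrightarrow> f mod p = f"
  for f p :: "'a::field poly"
  by (auto simp: low_iff mod_poly_less)

lemma bij_betw_low_Suc:
  "bij_betw (\<lambda>(c, f). pCons c f) (UNIV \<times> low a) (low (Suc a) :: 'a::zero poly set)"
proof (rule bij_betw_imageI)
  show "inj_on (\<lambda>(c, f). pCons c f) (UNIV \<times> low a :: ('a \<times> 'a poly) set)"
    by (auto simp: inj_on_def)
  show "(\<lambda>(c, f). pCons c f) ` (UNIV \<times> low a) = (low (Suc a) :: 'a poly set)"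
  proof (intro equalityI subsetI)
    fix f :: "'a poly" assume f: "f \<in> low (Suc a)"
    obtain c g where "f = pCons c g" by (cases f)
    moreover have "g \<in> low a"
      using f unfolding low_def \<open>f = pCons c g\<close> by (force simp: coeff_pCons_Suc)
    ultimately show "f \<in> (\<lambda>(c, f). pCons c f) ` (UNIV \<times> low a)" by auto
  qed (auto simp: low_def coeff_pCons split: nat.splits)
qed

lemma finite_low [simp, intro]: "finite (low a :: 'a::{finite,zero} poly set)"
proof (induction a)
  case (Suc a)
  then show ?case
    using bij_betw_finite[OF bij_betw_low_Suc] by (metis finite_SigmaI finite)
qed simp

lemma card_low: "card (low a :: 'a::{finite,zero} poly set) = CARD('a) ^ a"
proof (induction a)
  case (Suc a)
  then show ?case
    using bij_betw_same_card[OF bij_betw_low_Suc[where ?'a = 'a and a = a]]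
    by (simp add: card_cartesian_product)
qed simp

lemma nonzero_polys_below_eq: "nonzero_polys_below m = low m - {0}"
  by (auto simp: nonzero_polys_below_def low_iff)

section \<open>Digit polynomials of the integers\<close>

lemma CARD_gt_1: "CARD('f::prime_card) > 1"
  by (rule prime_gt_1_nat[OF prime_card])

lemma coeff_nat_poly:
  "Polynomial.coeff (nat_poly n :: 'f::prime_card mod_ring poly) i = of_nat (n div CARD('f) ^ i mod CARD('f))"
proof (cases "i \<le> n")
  case False
  then have "n < i" by simp
  also have "i < CARD('f) ^ i"
    using CARD_gt_1[where 'f = 'f] by (intro power_gt_expt) simp
  finally have "n < CARD('f) ^ i" .
  then show ?thesis using False
    by (simp add: nat_poly_def coeff_sum)
qed (simp add: nat_poly_def coeff_sum)

lemma nat_poly_rec: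
  "nat_poly n = pCons (of_nat (n mod CARD('f))) (nat_poly (n div CARD('f)) :: 'f::prime_card mod_ring poly)"
  by (rule poly_eqI) (auto simp: coeff_nat_poly coeff_pCons div_mult2_eq split: nat.splits)

lemma of_nat_mod_ring_inj:
  assumes "x < CARD('f)" "y < CARD('f)" "of_nat x = (of_nat y :: 'f::prime_card mod_ring)"
  shows "x = y"
proof -
  have "to_int_mod_ring (of_nat k :: 'f mod_ring) = int k" if "k < CARD('f)" for k
    using that by (simp add: of_nat_of_int_mod_ring)
  with assms show ?thesis by (metis of_nat_eq_iff)
qed

text \<open>Stripping the lowest digit passes to \<open>n div b\<close>, which is smaller only for
  \<open>n > 0\<close>. For \<open>n = 0\<close> all digits of \<open>n'\<close> vanish, and a
  second induction yields \<open>n' = 0\<close>.\<close>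

lemma nat_poly_inj: "nat_poly n = (nat_poly n' :: 'f::prime_card mod_ring poly) \<Longrightarrow> n = n'"
proof (induction n arbitrary: n' rule: less_induct)
  case (less n)
  let ?b = "CARD('f)"
  have b: "?b > 1" by (rule CARD_gt_1)
  have "pCons (of_nat (n mod ?b)) (nat_poly (n div ?b) :: 'f mod_ring poly)
      = pCons (of_nat (n' mod ?b)) (nat_poly (n' div ?b))"
    using less.prems nat_poly_rec[where 'f = 'f] by metis
  then have 1: "n mod ?b = n' mod ?b"
    and 2: "nat_poly (n div ?b) = (nat_poly (n' div ?b) :: 'f mod_ring poly)"
    using b by (auto intro!: of_nat_mod_ring_inj[where 'f = 'f])
  have "n div ?b = n' div ?b"
  proof (cases "n = 0")
    case True
    have "nat_poly 0 = (0 :: 'f mod_ring poly)" by (simp add: nat_poly_def)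
    with True less.prems have z: "nat_poly n' = (0 :: 'f mod_ring poly)" by simp
    have "n' div ?b ^ i mod ?b = 0" for i
    proof -
      have "of_nat (n' div ?b ^ i mod ?b) = (of_nat 0 :: 'f mod_ring)"
        using coeff_nat_poly[where 'f = 'f, of n' i] z by simp
      then show ?thesis using b by (intro of_nat_mod_ring_inj[where 'f = 'f]) auto
    qed
    then have "n' = 0"
    proof (induction n' rule: less_induct)
      case (less n')
      show ?case
      proof (rule ccontr)
        assume "n' \<noteq> 0"
        have "n' div ?b div ?b ^ i mod ?b = 0" for i
          using less.prems[of "Suc i"] by (simp add: div_mult2_eq)
        then have "n' div ?b = 0" using less.IH[of "n' div ?b"] b \<open>n' \<noteq> 0\<close> by simp
        moreover have "n' mod ?b = 0" using less.prems[of 0] by simp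
        ultimately show False using \<open>n' \<noteq> 0\<close> by (metis div_mult_mod_eq add_0 mult_0)
      qed
    qed
    with True show ?thesis by simp
  next
    case False
    with b have "n div ?b < n" by simp
    from less.IH[OF this 2] show ?thesis .
  qed
  with 1 show ?case by (metis div_mult_mod_eq)
qed

lemma nat_poly_low: "n < CARD('f) ^ m \<Longrightarrow> (nat_poly n :: 'f::prime_card mod_ring poly) \<in> low m"
proof -
  assume n: "n < CARD('f) ^ m"
  have "n div CARD('f) ^ i = 0" if "i \<ge> m" for i
  proof -
    have "CARD('f) ^ m \<le> CARD('f) ^ i"
      using that by (intro power_increasing) auto
    with n show ?thesis by simp
  qed
  then show ?thesis by (auto simp: low_def coeff_nat_poly)
qed

text \<open>Surjectivity follows by counting. Means over \<open>n < b^m\<close> thereby become means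
  over the group \<open>low m\<close>.\<close>

lemma bij_betw_nat_poly:
  "bij_betw (nat_poly :: nat \<Rightarrow> 'f::prime_card mod_ring poly) {..<CARD('f) ^ m} (low m)"
proof -
  have "inj_on (nat_poly :: nat \<Rightarrow> 'f mod_ring poly) {..<CARD('f) ^ m}"
    by (auto intro: inj_onI nat_poly_inj)
  moreover have "(nat_poly :: nat \<Rightarrow> 'f mod_ring poly) ` {..<CARD('f) ^ m} = low m"
    using calculation by (intro card_subset_eq) (auto simp: nat_poly_low card_low card_image)
  ultimately show ?thesis by (rule bij_betw_imageI)
qed

lemma card_low_nonzero:
  "real (card (low a - {0 :: 'f::prime_card mod_ring poly})) = real CARD('f) ^ a - 1"
  by (simp add: card_Diff_subset card_low of_nat_diff)

subsection \<open>Additive characters\<close>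

definition chi :: "'f::prime_card mod_ring \<Rightarrow> complex" where
  "chi x = cis (2 * pi * (of_int (to_int_mod_ring x) / real CARD('f)))"

lemma to_int_mod_ring_bounds:
  "0 \<le> to_int_mod_ring (x :: 'f::prime_card mod_ring)" "to_int_mod_ring x < int CARD('f)"
  using range_to_int_mod_ring[where 'a = 'f] by (auto simp: set_eq_iff image_iff)

lemma chi_0 [simp]: "chi 0 = 1"
  by (simp add: chi_def)

text \<open>The representative of \<open>x + y\<close> differs from the sum of the representatives
  by a multiple of \<open>b\<close>, that is, by full turns.\<close>

lemma chi_add: "chi (x + y) = chi x * chi (y :: 'f::prime_card mod_ring)"
proof -
  let ?b = "int CARD('f)" and ?x = "to_int_mod_ring x" and ?y = "to_int_mod_ring y"
  have "?x + ?y = ?b * ((?x + ?y) div ?b) + to_int_mod_ring (x + y)"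
    by (simp add: to_int_mod_ring_add)
  then have "real_of_int ?x + real_of_int ?y
      = real CARD('f) * of_int ((?x + ?y) div ?b) + of_int (to_int_mod_ring (x + y))"
    by (metis of_int_add of_int_mult of_int_of_nat_eq)
  then have "real_of_int ?x / real CARD('f) + of_int ?y / real CARD('f)
      = of_int ((?x + ?y) div ?b) + of_int (to_int_mod_ring (x + y)) / real CARD('f)"
    by (simp add: field_simps)
  then have "chi x * chi y
      = cis (2 * pi * (of_int ((?x + ?y) div ?b) + of_int (to_int_mod_ring (x + y)) / real CARD('f)))"
    by (simp only: chi_def cis_mult distrib_left[symmetric])
  also have "\<dots> = chi (x + y)"
    by (simp add: chi_def distrib_left cis_mult[symmetric])
  finally show ?thesis by simp
qed

lemma chi_eq_1_iff: "chi x = 1 \<longleftrightarrow> x = (0 :: 'f::prime_card mod_ring)"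
proof
  assume "chi x = 1"
  then obtain n :: int where "2 * pi * (of_int (to_int_mod_ring x) / real CARD('f)) = of_int n * (2 * pi)"
    unfolding chi_def cis_eq_1_iff by auto
  then have "2 * pi * (of_int (to_int_mod_ring x) / real CARD('f)) = 2 * pi * of_int n"
    by (simp only: mult.commute)
  then have "real_of_int (to_int_mod_ring x) / real CARD('f) = of_int n"
    by (subst (asm) mult_left_cancel) auto
  then have "real_of_int (to_int_mod_ring x) = of_int n * real CARD('f)"
    by (simp add: field_simps)
  then have eq: "to_int_mod_ring x = n * int CARD('f)"
    by (metis of_int_eq_iff of_int_mult of_int_of_nat_eq)
  have "to_int_mod_ring x mod int CARD('f) = 0" by (simp add: eq)
  then have "to_int_mod_ring x = 0"
    using to_int_mod_ring_bounds[of x] by simp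
  then show "x = 0" by simp
qed simp

lemma real_CARD_gt_1: "real CARD('f::prime_card) > 1"
  using CARD_gt_1[where 'f = 'f] by simp

text \<open>For \<open>degree p > 0\<close> this is the coefficient of \<open>x^-1\<close> in
  \<open>f / p\<close> times the leading coefficient of \<open>p\<close>. The nonzero factor only
  replaces the character \<open>chi\<close> by another nontrivial one.\<close>

definition lead_residue :: "'a::field poly \<Rightarrow> 'a poly \<Rightarrow> 'a" where
  "lead_residue p f = Polynomial.coeff (f mod p) (Polynomial.degree p - 1)"

definition char_mod :: "'f::prime_card mod_ring poly \<Rightarrow> 'f mod_ring poly \<Rightarrow> complex" where
  "char_mod p f = chi (lead_residue p f)"

lemma char_mod_0 [simp]: "char_mod p 0 = 1"
  by (simp add: char_mod_def lead_residue_def)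

lemma char_mod_add: "char_mod p (f + g) = char_mod p f * char_mod p g"
  by (simp add: char_mod_def lead_residue_def poly_mod_add_left chi_add)

lemma char_mod_cong: "f mod p = g mod p \<Longrightarrow> char_mod p f = char_mod p g"
  by (simp add: char_mod_def lead_residue_def)

lemma char_mod_low:
  assumes "f \<in> low (Polynomial.degree p - 1)"
  shows "char_mod p f = 1"
proof -
  have "f \<in> low (Polynomial.degree p)"
    using assms low_mono by (metis diff_le_self subsetD)
  then show ?thesis
    using assms by (simp add: char_mod_def lead_residue_def mod_low) (simp add: low_def)
qed

lemma char_mod_top:
  assumes "Polynomial.degree f = Polynomial.degree p - 1" "Polynomial.degree p > 0" "f \<noteq> 0"
  shows "char_mod p f \<noteq> 1"
proof -
  have "f mod p = f" using assms by (intro mod_low) (simp add: low_iff)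
  moreover have "Polynomial.coeff f (Polynomial.degree p - 1) \<noteq> 0"
    unfolding assms(1)[symmetric] using assms(3) by simp
  ultimately show ?thesis
    by (simp add: char_mod_def lead_residue_def chi_eq_1_iff)
qed

lemma sum_low_shift:
  fixes F :: "'a::{comm_ring_1,finite} poly \<Rightarrow> 'b::comm_monoid_add"
  assumes "k0 \<in> low a"
  shows "(\<Sum>k\<in>low a. F (k + k0)) = (\<Sum>k\<in>low a. F k)"
proof (rule sum.reindex_bij_witness[where i = "\<lambda>k. k - k0" and j = "\<lambda>k. k + k0"])
  have "- k0 \<in> low a" using assms by (simp add: low_def)
  then show "k - k0 \<in> low a" if "k \<in> low a" for k using low_add[of k a "- k0"] that by simp
qed (use assms in \<open>auto intro: low_add\<close>)

text \<open>For fixed \<open>h\<close> the summand is a character of the group \<open>low a\<close>.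
  It is trivial exactly if all products \<open>k * h\<close> lie in
  \<open>low (m - 1)\<close>.\<close>

lemma sum_char_mod_low:
  fixes p h :: "'f::prime_card mod_ring poly"
  assumes m: "m = Polynomial.degree p" "m > 0" and a: "a \<le> m" and h: "h \<in> low m"
  shows "(\<Sum>k\<in>low a. char_mod p (k * h)) = (if h \<in> low (m - a) then of_nat (CARD('f) ^ a) else 0)"
proof (cases "h \<in> low (m - a)")
  case True
  have "char_mod p (k * h) = 1" if k: "k \<in> low a" for k
  proof (cases "k * h = 0")
    case False
    then have "Polynomial.degree k < a" "Polynomial.degree h < m - a"
      using k True by (auto simp: low_iff)
    then show ?thesis using False m by (intro char_mod_low) (auto simp: low_iff degree_mult_eq)
  qed auto
  with True show ?thesis by (simp add: card_low)
next
  case False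
  then have h0: "h \<noteq> 0" and dh: "m - a \<le> Polynomial.degree h" "Polynomial.degree h < m"
    using h by (auto simp: low_iff)
  \<comment> \<open>This monomial lifts \<open>h\<close> to degree exactly \<open>m - 1\<close>,
    where the character is nontrivial; shifting the sum by it multiplies the sum by a factor other
    than 1.\<close>
  define k0 :: "'f mod_ring poly" where "k0 = Polynomial.monom 1 (m - 1 - Polynomial.degree h)"
  have k0: "k0 \<in> low a" using dh m a by (simp add: low_iff k0_def degree_monom_eq)
  have "k0 \<noteq> 0" by (simp add: k0_def)
  then have "Polynomial.degree (k0 * h) = m - 1"
    using dh h0 by (simp add: degree_mult_eq) (simp add: k0_def degree_monom_eq)
  then have ne: "char_mod p (k0 * h) \<noteq> 1"
    using m h0 \<open>k0 \<noteq> 0\<close> by (intro char_mod_top) auto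
  have "(\<Sum>k\<in>low a. char_mod p (k * h)) = (\<Sum>k\<in>low a. char_mod p ((k + k0) * h))"
    using sum_low_shift[OF k0, of "\<lambda>k. char_mod p (k * h)"] by simp
  also have "\<dots> = (\<Sum>k\<in>low a. char_mod p (k * h)) * char_mod p (k0 * h)"
    by (simp add: distrib_right char_mod_add sum_distrib_right)
  finally have "(\<Sum>k\<in>low a. char_mod p (k * h)) = 0" using ne by simp
  with False show ?thesis by simp
qed

text \<open>Nonzero polynomials of degree \<open>a\<close> form \<open>low (Suc a) - low a\<close>,
  also for \<open>a = 0\<close> because \<open>low 0 = {0}\<close>. Used with characters for
  \<open>F\<close> to expand \<open>\<phi>2\<close>, and with \<open>F = 1\<close> for
  counting.\<close>

lemma sum_low_degree:
  fixes f :: "nat \<Rightarrow> 'b::comm_ring" and F :: "'a::{finite,zero} poly \<Rightarrow> 'b"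
  shows "(\<Sum>k\<in>low m - {0}. f (Polynomial.degree k) * F k)
    = (\<Sum>a<m. f a * ((\<Sum>k\<in>low (Suc a). F k) - (\<Sum>k\<in>low a. F k)))"
proof (induction m)
  case (Suc m)
  let ?D = "low (Suc m) - low m :: 'a poly set"
  have sub: "low m \<subseteq> (low (Suc m) :: 'a poly set)" by (rule low_mono) simp
  have deg: "Polynomial.degree k = m" if "k \<in> ?D" for k
    using that by (auto simp: low_iff)
  have "(\<Sum>k\<in>low (Suc m) - {0}. f (Polynomial.degree k) * F k)
      = (\<Sum>k\<in>low m - {0}. f (Polynomial.degree k) * F k) + (\<Sum>k\<in>?D. f (Polynomial.degree k) * F k)"
    using sub by (subst sum.union_disjoint[symmetric]) (auto intro!: sum.cong)
  also have "(\<Sum>k\<in>?D. f (Polynomial.degree k) * F k) = f m * (\<Sum>k\<in>?D. F k)"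
    by (simp add: deg sum_distrib_left)
  also have "(\<Sum>k\<in>?D. F k) = (\<Sum>k\<in>low (Suc m). F k) - (\<Sum>k\<in>low m. F k)"
    using sub by (simp add: sum_diff)
  finally show ?case by (simp add: Suc)
qed simp

text \<open>The case \<open>a = m\<close> of \<open>sum_char_mod_low\<close>, where
  \<open>low 0\<close> leaves only the residue 0.\<close>

lemma sum_char_mod:
  fixes p f :: "'f::prime_card mod_ring poly"
  assumes m: "m = Polynomial.degree p" "m > 0"
  shows "(\<Sum>h\<in>low m. char_mod p (f * h)) = (if p dvd f then of_nat (CARD('f) ^ m) else 0)"
proof -
  have "p \<noteq> 0" using m by auto
  then have l: "f mod p \<in> low m" unfolding m(1) by (rule low_mod)
  have "(\<Sum>h\<in>low m. char_mod p (f * h)) = (\<Sum>h\<in>low m. char_mod p (h * (f mod p)))"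
    by (intro sum.cong refl char_mod_cong) (simp add: mod_mult_right_eq mult.commute)
  also have "\<dots> = (if p dvd f then of_nat (CARD('f) ^ m) else 0)"
    by (subst sum_char_mod_low[OF m _ l]) (auto simp: dvd_eq_mod_eq_0)
  finally show ?thesis .
qed

subsection \<open>Leading digits of the lattice points\<close>

text \<open>A lattice point depends on \<open>n\<close> and \<open>q j\<close> only through the
  product of their polynomials, which is \<open>f\<close> here.\<close>

definition pt :: "'f::prime_card mod_ring poly \<Rightarrow> 'f mod_ring poly \<Rightarrow> real" where
  "pt p f = v_trunc (Polynomial.degree p) (laurent_of_poly f / laurent_of_poly p)"

section \<open>Polynomials as Laurent series in \<open>x^-1\<close>\<close>

lemma laurent_nth: "fls_nth (laurent_of_poly f) l = (if l \<le> 0 then Polynomial.coeff f (nat (- l)) else 0)"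
proof -
  have "fls_nth (\<Sum>i\<in>A. G i) l = (\<Sum>i\<in>A. fls_nth (G i) l)" for A and G :: "nat \<Rightarrow> 'a fls"
    by (induction A rule: infinite_finite_induct) auto
  then have eq: "fls_nth (laurent_of_poly f) l
      = (\<Sum>i\<le>Polynomial.degree f. Polynomial.coeff f i * (if l = - int i then 1 else 0))"
    by (simp add: laurent_of_poly_def)
  show ?thesis
  proof (cases "l \<le> 0")
    case True
    then have "l = - int i \<longleftrightarrow> nat (- l) = i" for i by auto
    then show ?thesis using True coeff_eq_0[of f "nat (- l)"]
      unfolding eq by (auto simp: if_distrib cong: if_cong)
  next
    case False
    then have "l \<noteq> - int i" for i by auto
    then show ?thesis using False unfolding eq by simp
  qed
qed

lemma laurent_add: "laurent_of_poly (f + g) = laurent_of_poly f + laurent_of_poly g"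
  by (rule fls_eqI) (simp add: laurent_nth)

lemma laurent_0 [simp]: "laurent_of_poly 0 = 0"
  by (rule fls_eqI) (simp add: laurent_nth)

lemma laurent_pCons: "laurent_of_poly (pCons c f) = fls_const c + fls_X_inv * laurent_of_poly f"
proof (rule fls_eqI)
  fix l :: int
  show "fls_nth (laurent_of_poly (pCons c f)) l = fls_nth (fls_const c + fls_X_inv * laurent_of_poly f) l"
  proof (cases "l < 0")
    case True
    then have "nat (- l) = Suc (nat (- (l + 1)))" by simp
    with True show ?thesis by (simp add: laurent_nth fls_X_inv_times_conv_shift)
  qed (auto simp: laurent_nth fls_X_inv_times_conv_shift)
qed

lemma laurent_smult: "laurent_of_poly (Polynomial.smult c f) = fls_const c * laurent_of_poly f"
  by (rule fls_eqI) (simp add: laurent_nth)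

lemma laurent_mult: "laurent_of_poly (f * g) = laurent_of_poly f * laurent_of_poly g"
proof (induction f)
  case (pCons c f)
  then show ?case
    by (simp add: laurent_pCons laurent_add laurent_smult mult_pCons_left algebra_simps)
qed simp

lemma laurent_eq_0_iff [simp]: "laurent_of_poly f = 0 \<longleftrightarrow> f = 0"
proof
  assume "laurent_of_poly f = 0"
  then have "fls_nth (laurent_of_poly f) (- int (Polynomial.degree f)) = 0" by simp
  then show "f = 0" by (simp add: laurent_nth)
qed simp

lemma subdegree_laurent: "f \<noteq> 0 \<Longrightarrow> fls_subdegree (laurent_of_poly f) = - int (Polynomial.degree f)"
  by (rule fls_subdegree_eqI) (auto simp: laurent_nth intro!: coeff_eq_0)

text \<open>\<open>f / p\<close> and \<open>(f mod p) / p\<close> differ by a polynomial, which has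
  no coefficients at \<open>x^-l\<close> with \<open>l \<ge> 1\<close>.\<close>

lemma pt_mod:
  assumes "p \<noteq> 0"
  shows "pt p (f mod p) = pt p f"
proof -
  have "laurent_of_poly f = laurent_of_poly (f div p * p + f mod p)" by simp
  also have "\<dots> = laurent_of_poly (f div p) * laurent_of_poly p + laurent_of_poly (f mod p)"
    unfolding laurent_add laurent_mult ..
  finally have "laurent_of_poly f / laurent_of_poly p
      = laurent_of_poly (f div p) + laurent_of_poly (f mod p) / laurent_of_poly p"
    using assms by (simp add: add_divide_distrib)
  then show ?thesis
    by (auto simp: pt_def v_trunc_def laurent_nth intro!: sum.cong)
qed

lemma pt_0 [simp]: "pt p 0 = 0"
  by (simp add: pt_def v_trunc_def)

text \<open>A finite digit sum starting at position \<open>w\<close> stays strictly below the full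
  geometric series.\<close>

lemma sum_digits_less:
  fixes t :: "nat \<Rightarrow> real" and b :: real
  assumes b: "b > 1" and t: "\<And>l. t l \<le> b - 1" "\<And>l. l < w \<Longrightarrow> t l = 0" and "w > 0"
  shows "(\<Sum>l = 1..m. t l / b ^ l) < 1 / b ^ (w - 1)"
proof (cases "w \<le> m")
  case True
  \<comment> \<open>Each term is a difference of consecutive powers, so the sum telescopes; the
    subtracted end term makes the bound strict.\<close>
  have eq: "(\<Sum>l = w..<w + n. (b - 1) / b ^ l) = 1 / b ^ (w - 1) - 1 / b ^ (w + n - 1)" for n
  proof (induction n)
    case (Suc n)
    have "(b - 1) / b ^ (w + n) = 1 / b ^ (w + n - 1) - 1 / b ^ (w + n)"
      using b \<open>w > 0\<close> by (cases w) (auto simp: field_simps)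
    then show ?case by (simp add: Suc)
  qed simp
  have "(\<Sum>l = 1..m. t l / b ^ l) = (\<Sum>l = w..m. t l / b ^ l)"
    using t(2) \<open>w > 0\<close> by (intro sum.mono_neutral_right) auto
  also have "\<dots> \<le> (\<Sum>l = w..m. (b - 1) / b ^ l)"
    using b t(1) by (intro sum_mono divide_right_mono) auto
  also have "{w..m} = {w..<w + (Suc m - w)}" using True by auto
  also have "(\<Sum>l = w..<w + (Suc m - w). (b - 1) / b ^ l) < 1 / b ^ (w - 1)"
    unfolding eq using b by simp
  finally show ?thesis .
next
  case False
  then have "(\<Sum>l = 1..m. t l / b ^ l) = 0" using t(2) by (intro sum.neutral) auto
  then show ?thesis using b by simp
qed

text \<open>\<open>h / p\<close> has order \<open>w = degree p - degree h\<close> in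
  \<open>x^-1\<close>. Its first nonzero digit sits at position \<open>w \<le> degree p\<close>, so
  truncation keeps it and the point lies between \<open>b^-w\<close> and
  \<open>b^-(w-1)\<close>.\<close>

lemma floor_log_pt:
  fixes p h :: "'f::prime_card mod_ring poly"
  assumes h: "h \<noteq> 0" "Polynomial.degree h < Polynomial.degree p"
  shows "pt p h > 0" "\<lfloor>log (real CARD('f)) (pt p h)\<rfloor> = int (Polynomial.degree h) - int (Polynomial.degree p)"
proof -
  let ?b = "real CARD('f)"
  define m where "m = Polynomial.degree p"
  define w where "w = m - Polynomial.degree h"
  have w: "0 < w" "w \<le> m" using h by (auto simp: w_def m_def)
  have b: "?b > 1" by (rule real_CARD_gt_1)
  define f where "f = laurent_of_poly h / laurent_of_poly p"
  have p: "p \<noteq> 0" using h by auto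
  have "f \<noteq> 0" using h p by (simp add: f_def)
  have sd: "fls_subdegree f = int w"
  proof -
    have "laurent_of_poly h = f * laurent_of_poly p" using p by (simp add: f_def)
    then have "fls_subdegree (laurent_of_poly h) = fls_subdegree f + fls_subdegree (laurent_of_poly p)"
      using \<open>f \<noteq> 0\<close> p by simp
    then show ?thesis using h p by (simp add: subdegree_laurent w_def m_def)
  qed
  define t where "t l = real_of_int (to_int_mod_ring (fls_nth f (int l)))" for l
  have t0: "t l = 0" if "l < w" for l
    using that sd by (simp add: t_def)
  have tb: "0 \<le> t l" "t l \<le> ?b - 1" for l
    using to_int_mod_ring_bounds[of "fls_nth f (int l)"] by (auto simp: t_def)
  have "fls_nth f (int w) \<noteq> 0" using nth_fls_subdegree_nonzero[OF \<open>f \<noteq> 0\<close>] sd by simp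
  then have "to_int_mod_ring (fls_nth f (int w)) \<noteq> 0" by simp
  then have tw: "t w \<ge> 1"
    using to_int_mod_ring_bounds(1)[of "fls_nth f (int w)"] unfolding t_def by linarith
  have pt: "pt p h = (\<Sum>l = 1..m. t l / ?b ^ l)"
    by (simp add: pt_def v_trunc_def t_def f_def m_def)
  have "1 / ?b ^ w \<le> t w / ?b ^ w" using tw by (intro divide_right_mono) auto
  also have "\<dots> \<le> pt p h"
    unfolding pt using w tb by (intro member_le_sum) auto
  finally have lower: "1 / ?b ^ w \<le> pt p h" .
  then show pos: "pt p h > 0" using b by (smt (verit) zero_less_divide_1_iff zero_less_power)
  have upper: "pt p h < 1 / ?b ^ (w - 1)"
    unfolding pt using b tb t0 w by (intro sum_digits_less) auto
  have "\<lfloor>log ?b (pt p h)\<rfloor> = - int w"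
  proof (subst floor_log_eq_powr_iff[OF pos b], intro conjI)
    have "?b powr - real w = 1 / ?b ^ w" using b by (simp add: powr_minus powr_realpow field_simps)
    then show "?b powr real_of_int (- int w) \<le> pt p h" using lower by simp
    have "?b powr - (real w - 1) = 1 / ?b ^ (w - 1)"
      using b w powr_realpow[of ?b "w - 1"] powr_minus_divide[of ?b "real w - 1"]
      by (simp add: of_nat_diff)
    then show "pt p h < ?b powr real_of_int (- int w + 1)" using upper by simp
  qed
  then show "\<lfloor>log ?b (pt p h)\<rfloor> = int (Polynomial.degree h) - int (Polynomial.degree p)"
    using h by (simp add: w_def m_def)
qed

subsection \<open>Fourier coefficients of \<open>\<phi>\<close>\<close>

text \<open>
  \<open>phi_max b (b ^ d)\<close> is the value of \<open>\<phi>\<close> at \<open>0\<close>, that is, the full series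
  \<open>\<Sum>\<^sub>a (b\<^sup>a\<^sup>+\<^sup>1 - b\<^sup>a) / b\<^sup>d\<^sup>a\<close>; with \<open>b powr (lam * d)\<close> in place of \<open>b ^ d\<close> it is the
  sum of the \<open>lam\<close>-th powers of all Walsh coefficients.
\<close>

definition phi_max :: "real \<Rightarrow> real \<Rightarrow> real" where
  "phi_max b B = B * (b - 1) / (B - b)"

text \<open>\<open>b^(a+1) - b^a\<close> counts the nonzero polynomials of degree \<open>a\<close>.
  The sum is needed with \<open>B = b^d\<close> for values of \<open>\<phi>2\<close> and with
  \<open>B = b powr (lam * d)\<close> for power sums.\<close>

lemma sum_phi_max:
  assumes "1 < b" "b < B"
  shows "(\<Sum>a<m. (b ^ Suc a - b ^ a) / B ^ a) = phi_max b B * (1 - (b / B) ^ m)"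
proof (induction m)
  case (Suc m)
  have "(b ^ Suc m - b ^ m) / B ^ m = phi_max b B * ((b / B) ^ m * (1 - b / B))"
    using assms by (simp add: phi_max_def power_divide field_simps)
  then show ?case
    unfolding sum.lessThan_Suc Suc.IH by (simp only:) (simp add: algebra_simps)
qed simp

lemma phi2_zero:
  assumes "1 < b" "1 < d"
  shows "\<phi>2 b d 0 = phi_max (real b) (real b ^ d)"
proof -
  obtain e where e: "d = Suc (Suc e)" using le_Suc_ex[of 2 d] assms by auto
  have "real b * (real b * real b ^ e) - real b = real b * (real b * real b ^ e - 1)"
    by (simp add: algebra_simps)
  then show ?thesis using assms unfolding e by (simp add: \<phi>2_def phi_max_def)
qed

text \<open>The shape anticipates the character sums: degrees below \<open>w - 1\<close> contribute
  their full count, degree \<open>w - 1\<close> gives the negative last term, higher degrees give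
  nothing.\<close>

lemma phi2_nonzero:
  assumes b: "1 < b" and d: "1 < d" and w: "0 < w"
    and z: "0 < z" "\<lfloor>log (real b) z\<rfloor> = - int w"
  shows "\<phi>2 b d z = phi_max (real b) (real b ^ d) * (1 - (real b / real b ^ d) ^ (w - 1))
    - (real b / real b ^ d) ^ (w - 1)"
proof -
  obtain e where e: "d = Suc (Suc e)" using le_Suc_ex[of 2 d] d by auto
  obtain u where u: "w = Suc u" using w by (cases w) auto
  \<comment> \<open>With \<open>x = b^(d-1)\<close>, cancelling \<open>b\<close> turns
    \<open>phi_max b (b^d)\<close> into \<open>x * (b - 1) / (x - 1)\<close>, which has the
    denominator of \<open>\<phi>2\<close>.\<close>
  define x where "x = real b ^ (d - 1)"
  have x: "x > 1" using b d by (simp add: x_def one_less_power)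
  have bd: "real b ^ d = real b * x" by (simp add: x_def e)
  define y where "y = 1 / x ^ u"
  have y: "(real b / real b ^ d) ^ (w - 1) = y"
    using b by (simp add: bd y_def u power_divide power_mult_distrib)
  have "real b powi (int (d - 1) * - int w) = inverse (x ^ w)"
    by (simp add: power_int_minus x_def flip: power_mult of_nat_mult)
  also have "\<dots> = y / x" using x by (simp add: y_def u field_simps)
  finally have "\<phi>2 b d z = x * (real b - 1 - y / x * (real b * x - 1)) / (x - 1)"
    using z x_def by (simp add: \<phi>2_def bd)
  also have "\<dots> = (x * (real b - 1) - y * (real b * x - 1)) / (x - 1)"
    using x by (simp add: field_simps)
  also have "\<dots> = (x * (real b - 1)) / (x - 1) * (1 - y) - y"
    using x by (simp add: field_simps)
  also have "(x * (real b - 1)) / (x - 1) = phi_max (real b) (real b ^ d)"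
  proof -
    have "real b * x - real b = real b * (x - 1)" by (simp add: algebra_simps)
    then show ?thesis using b by (simp add: phi_max_def bd)
  qed
  finally show ?thesis unfolding y .
qed

text \<open>
  The finite Fourier coefficients of \<open>\<phi>\<close>. The second summand collects the Walsh coefficients beyond
  resolution \<open>b\<^sup>m\<close>: they only contribute at the point \<open>0\<close>, whose indicator has constant spectrum.
\<close>

definition phi_coeff :: "'f::prime_card mod_ring poly \<Rightarrow> nat \<Rightarrow> 'f mod_ring poly \<Rightarrow> real" where
  "phi_coeff p d k = (if k = 0 then 0 else 1 / (real CARD('f) ^ d) ^ Polynomial.degree k)
     + phi_max (real CARD('f)) (real CARD('f) ^ d) / (real CARD('f) ^ d) ^ Polynomial.degree p"

text \<open>Grouping \<open>k\<close> by degree turns the sum into differences of the character sums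
  over \<open>low a\<close>. The constant part of \<open>phi_coeff\<close> vanishes for
  \<open>h \<noteq> 0\<close>, and at \<open>h = 0\<close> supplies exactly the missing tail of the
  series.\<close>

lemma phi_expansion_low:
  fixes p h :: "'f::prime_card mod_ring poly"
  assumes d: "1 < d" and m: "0 < Polynomial.degree p" and h: "h \<in> low (Polynomial.degree p)"
  shows "complex_of_real (\<phi>2 CARD('f) d (pt p h))
    = (\<Sum>k\<in>low (Polynomial.degree p). complex_of_real (phi_coeff p d k) * char_mod p (k * h))"
proof -
  let ?b = "real CARD('f)" and ?m = "Polynomial.degree p"
  define B where "B = ?b ^ d"
  have b: "?b > 1" by (rule real_CARD_gt_1)
  have B: "?b < B" using power_strict_increasing[OF d b] by (simp add: B_def)
  define s :: "nat \<Rightarrow> real" where "s a = (if h \<in> low (?m - a) then ?b ^ a else 0)" for a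
  have s: "(\<Sum>k\<in>low a. char_mod p (k * h)) = complex_of_real (s a)" if "a \<le> ?m" for a
    using sum_char_mod_low[OF refl m that h] by (simp add: s_def)
  have "(\<Sum>k\<in>low ?m. complex_of_real (phi_coeff p d k) * char_mod p (k * h))
      = (\<Sum>k\<in>low ?m. (if k = 0 then 0 else (1 / complex_of_real B ^ Polynomial.degree k) * char_mod p (k * h)))
        + complex_of_real (phi_max ?b B / B ^ ?m) * (\<Sum>k\<in>low ?m. char_mod p (k * h))"
    unfolding sum_distrib_left sum.distrib[symmetric]
    by (intro sum.cong) (auto simp: phi_coeff_def B_def algebra_simps)
  also have "(\<Sum>k\<in>low ?m. (if k = 0 then 0 else (1 / complex_of_real B ^ Polynomial.degree k) * char_mod p (k * h)))
      = (\<Sum>k\<in>low ?m - {0}. (1 / complex_of_real B ^ Polynomial.degree k) * char_mod p (k * h))"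
    by (intro sum.mono_neutral_cong_right) auto
  also have "\<dots> = (\<Sum>a<?m. 1 / complex_of_real B ^ a * (complex_of_real (s (Suc a)) - complex_of_real (s a)))"
    by (subst sum_low_degree[where f = "\<lambda>a. 1 / complex_of_real B ^ a"]) (auto intro!: sum.cong simp: s)
  also have "\<dots> = complex_of_real (\<Sum>a<?m. (s (Suc a) - s a) / B ^ a)"
    by simp
  also have "(\<Sum>k\<in>low ?m. char_mod p (k * h)) = complex_of_real (s ?m)"
    by (rule s) simp
  finally have eq: "(\<Sum>k\<in>low ?m. complex_of_real (phi_coeff p d k) * char_mod p (k * h))
      = complex_of_real ((\<Sum>a<?m. (s (Suc a) - s a) / B ^ a) + phi_max ?b B / B ^ ?m * s ?m)"
    by simp
  have "\<phi>2 CARD('f) d (pt p h) = (\<Sum>a<?m. (s (Suc a) - s a) / B ^ a) + phi_max ?b B / B ^ ?m * s ?m"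
  proof (cases "h = 0")
    case True
    then have "s = (\<lambda>a. ?b ^ a)" by (auto simp: s_def)
    then have "(\<Sum>a<?m. (s (Suc a) - s a) / B ^ a) + phi_max ?b B / B ^ ?m * s ?m
        = phi_max ?b B * (1 - (?b / B) ^ ?m) + phi_max ?b B * (?b / B) ^ ?m"
      using sum_phi_max[OF b B, of ?m] by (simp add: power_divide)
    also have "\<dots> = phi_max ?b B" by (simp add: algebra_simps)
    finally show ?thesis using True phi2_zero[of "CARD('f)" d] b d by (simp add: B_def)
  next
    case False
    then have dh: "Polynomial.degree h < ?m" using h by (simp add: low_iff)
    \<comment> \<open>\<open>u\<close> is the last \<open>a\<close> for which the character sum over
      \<open>low a\<close> is nonzero.\<close>
    define u where "u = ?m - Polynomial.degree h - 1"
    have m_eq: "?m = Suc u + Polynomial.degree h" using dh by (simp add: u_def)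
    have s_eq: "s a = (if a \<le> u then ?b ^ a else 0)" for a
      using False by (auto simp: s_def low_iff m_eq)
    have "(\<Sum>a<?m. (s (Suc a) - s a) / B ^ a) = (\<Sum>a<Suc u. (s (Suc a) - s a) / B ^ a)"
      by (rule sum.mono_neutral_right) (auto simp: s_eq m_eq)
    also have "\<dots> = (\<Sum>a<u. (?b ^ Suc a - ?b ^ a) / B ^ a) - (?b / B) ^ u"
      by (simp add: s_eq power_divide)
    also have "(\<Sum>a<u. (?b ^ Suc a - ?b ^ a) / B ^ a) = phi_max ?b B * (1 - (?b / B) ^ u)"
      by (rule sum_phi_max[OF b B])
    finally have 1: "(\<Sum>a<?m. (s (Suc a) - s a) / B ^ a)
        = phi_max ?b B * (1 - (?b / B) ^ u) - (?b / B) ^ u" .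
    have 2: "s ?m = 0" by (simp add: s_eq m_eq)
    have fl: "\<lfloor>log ?b (pt p h)\<rfloor> = - int (Suc u)"
      using floor_log_pt(2)[OF False dh] by (simp add: m_eq)
    have "\<phi>2 CARD('f) d (pt p h) = phi_max ?b B * (1 - (?b / B) ^ u) - (?b / B) ^ u"
      using phi2_nonzero[OF CARD_gt_1 d _ floor_log_pt(1)[OF False dh] fl]
      by (simp add: B_def)
    with 1 2 show ?thesis by simp
  qed
  then show ?thesis unfolding eq by simp
qed

lemma phi_expansion:
  fixes p f :: "'f::prime_card mod_ring poly"
  assumes d: "1 < d" and m: "0 < Polynomial.degree p"
  shows "complex_of_real (\<phi>2 CARD('f) d (pt p f))
    = (\<Sum>k\<in>low (Polynomial.degree p). complex_of_real (phi_coeff p d k) * char_mod p (k * f))"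
proof -
  have p: "p \<noteq> 0" using m by auto
  have "char_mod p (k * (f mod p)) = char_mod p (k * f)" for k
    by (intro char_mod_cong) (simp add: mod_mult_right_eq)
  with phi_expansion_low[OF d m low_mod[OF p, of f]] show ?thesis
    by (simp add: pt_mod[OF p])
qed

lemma phi_max_nonneg: "1 < b \<Longrightarrow> b < B \<Longrightarrow> phi_max b B \<ge> 0"
  by (simp add: phi_max_def)

lemma phi_coeff_nonneg:
  fixes p k :: "'f::prime_card mod_ring poly"
  assumes d: "1 < d"
  shows "phi_coeff p d k \<ge> 0"
proof -
  have "real CARD('f) < real CARD('f) ^ d"
    using power_strict_increasing[OF d real_CARD_gt_1[where 'f = 'f]] by simp
  then have "phi_max (real CARD('f)) (real CARD('f) ^ d) \<ge> 0"
    by (intro phi_max_nonneg real_CARD_gt_1)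
  then show ?thesis by (simp add: phi_coeff_def)
qed

text \<open>Pulling \<open>b^d\<close> out of \<open>phi_max\<close> leaves the base of the first
  term of the maximum in \<open>G2_tilde\<close>.\<close>

lemma phi_max_powr_le:
  fixes b lam G :: real
  assumes b: "1 < b" and d: "1 < d" and lam: "0 < lam"
    and G: "((b - 1) / (b ^ d - b)) powr lam \<le> G"
  shows "phi_max (b) (b ^ d) powr lam \<le> b powr (lam * real d) * G"
proof -
  have B: "b < b ^ d" using power_strict_increasing[OF d b] by simp
  have "phi_max b (b ^ d) powr lam = (b ^ d * ((b - 1) / (b ^ d - b))) powr lam"
    by (simp add: phi_max_def)
  also have "\<dots> = (b ^ d) powr lam * ((b - 1) / (b ^ d - b)) powr lam"
    by (rule powr_mult)
  also have "(b ^ d) powr lam = b powr (lam * real d)"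
    using b by (simp add: powr_powr mult.commute flip: powr_realpow)
  finally show ?thesis using G by (simp add: mult_left_mono)
qed

lemma power_mult_powr:
  fixes b lam :: real
  assumes "b > 0"
  shows "((b ^ d) ^ n) powr lam = (b powr (lam * real d)) ^ n"
  using assms by (simp add: powr_powr powr_power mult_ac flip: powr_realpow power_mult)

text \<open>Frequency 0 is the same for every candidate, so averaging gains nothing there. The gain
  comes from the size of the coefficient, as \<open>lam * d > 1\<close> gives
  \<open>b^m - 1 \<le> b powr (lam * d * m)\<close>.\<close>

lemma phi_coeff_0_powr_le:
  fixes p :: "'f::prime_card mod_ring poly"
  assumes d: "1 < d" and lam: "0 < lam" "1 < lam * real d" and m: "0 < Polynomial.degree p"
    and G: "((real CARD('f) - 1) / (real CARD('f) ^ d - real CARD('f))) powr lam \<le> G"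
  shows "phi_coeff p d 0 powr lam
    \<le> real CARD('f) powr (lam * real d) * G / (real CARD('f) ^ Polynomial.degree p - 1)"
proof -
  let ?b = "real CARD('f)" and ?m = "Polynomial.degree p"
  let ?M = "?b powr (lam * real d) * G"
  have b: "?b > 1" by (rule real_CARD_gt_1)
  have bm: "?b ^ ?m > 1" using b m by (simp add: one_less_power)
  have M: "phi_max ?b (?b ^ d) powr lam \<le> ?M" by (rule phi_max_powr_le[OF b d lam(1) G])
  have M0: "?M \<ge> 0" using M by (rule order_trans[rotated]) simp
  have B: "?b < ?b powr (lam * real d)"
    using powr_less_mono[OF lam(2) b] b by simp
  have pm: "phi_max ?b (?b ^ d) \<ge> 0"
    using power_strict_increasing[OF d b] by (intro phi_max_nonneg b) simp
  have "phi_coeff p d 0 powr lam = phi_max ?b (?b ^ d) powr lam / (?b powr (lam * real d)) ^ ?m"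
    using b pm by (simp add: phi_coeff_def powr_divide power_mult_powr)
  also have "\<dots> \<le> ?M / (?b ^ ?m - 1)"
  proof (rule frac_le)
    have "?b ^ ?m \<le> (?b powr (lam * real d)) ^ ?m" using b B by (intro power_mono) auto
    then show "?b ^ ?m - 1 \<le> (?b powr (lam * real d)) ^ ?m" by simp
  qed (use M M0 bm in auto)
  finally show ?thesis .
qed

text \<open>Subadditivity separates the coefficients proper from the folded tail. Their power sums
  are \<open>phi_max b B * (1 - r)\<close> and \<open>P powr lam * r\<close>, a convex combination
  of two quantities, each bounded through one term of the maximum in
  \<open>G2_tilde\<close>.\<close>

lemma sum_phi_coeff_powr_le:
  fixes p :: "'f::prime_card mod_ring poly"
  assumes d: "1 < d" and lam: "0 < lam" "lam \<le> 1" "1 < lam * real d"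
    and G: "((real CARD('f) - 1) / (real CARD('f) ^ d - real CARD('f))) powr lam \<le> G"
      "(real CARD('f) - 1) / (real CARD('f) powr (lam * real d) - real CARD('f)) \<le> G"
  shows "(\<Sum>k\<in>low (Polynomial.degree p). phi_coeff p d k powr lam) \<le> real CARD('f) powr (lam * real d) * G"
proof -
  let ?b = "real CARD('f)" and ?m = "Polynomial.degree p"
  define B where "B = ?b powr (lam * real d)"
  define P where "P = phi_max ?b (?b ^ d)"
  have b: "?b > 1" by (rule real_CARD_gt_1)
  have B: "?b < B"
    using powr_less_mono[OF lam(3) b] b by (simp add: B_def)
  have P: "P \<ge> 0"
    unfolding P_def using power_strict_increasing[OF d b] by (intro phi_max_nonneg b) simp
  have M1: "P powr lam \<le> B * G"
    unfolding P_def B_def by (rule phi_max_powr_le[OF b d lam(1) G(1)])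
  have M2: "phi_max ?b B \<le> B * G"
  proof -
    have "phi_max ?b B = B * ((?b - 1) / (B - ?b))" by (simp add: phi_max_def)
    also have "\<dots> \<le> B * G" using G(2) B b by (intro mult_left_mono) (auto simp: B_def)
    finally show ?thesis .
  qed
  have pw: "((?b ^ d) ^ n) powr lam = B ^ n" for n
    unfolding B_def using b by (intro power_mult_powr) simp
  \<comment> \<open>The share of the tail: \<open>b^m\<close> equal coefficients, each carrying the
    factor \<open>1 / B^m\<close>.\<close>
  define r where "r = (?b / B) ^ ?m"
  have r: "0 \<le> r" "r \<le> 1" using b B by (auto simp: r_def intro!: power_le_one)
  have "phi_coeff p d k powr lam \<le> (if k = 0 then 0 else 1 / B ^ Polynomial.degree k) + P powr lam / B ^ ?m" for k
  proof -
    have "phi_coeff p d k powr lam \<le> (if k = 0 then 0 else 1 / (?b ^ d) ^ Polynomial.degree k) powr lam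
        + (P / (?b ^ d) ^ ?m) powr lam"
      unfolding phi_coeff_def P_def[symmetric] using P lam by (intro powr_add_le) auto
    also have "\<dots> = (if k = 0 then 0 else 1 / B ^ Polynomial.degree k) + P powr lam / B ^ ?m"
      using P by (simp add: powr_divide pw)
    finally show ?thesis .
  qed
  then have "(\<Sum>k\<in>low ?m. phi_coeff p d k powr lam)
      \<le> (\<Sum>k\<in>low ?m. (if k = (0 :: 'f mod_ring poly) then 0 else 1 / B ^ Polynomial.degree k) + P powr lam / B ^ ?m)"
    by (intro sum_mono)
  also have "\<dots> = (\<Sum>k\<in>low ?m. if k = (0 :: 'f mod_ring poly) then 0 else 1 / B ^ Polynomial.degree k)
      + of_nat (card (low ?m :: 'f mod_ring poly set)) * (P powr lam / B ^ ?m)"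
    by (simp add: sum.distrib)
  also have "of_nat (card (low ?m :: 'f mod_ring poly set)) * (P powr lam / B ^ ?m) = P powr lam * r"
    by (simp add: card_low r_def power_divide)
  also have "(\<Sum>k\<in>low ?m. if k = 0 then 0 else 1 / B ^ Polynomial.degree (k :: 'f mod_ring poly))
      = (\<Sum>k\<in>low ?m - {0 :: 'f mod_ring poly}. 1 / B ^ Polynomial.degree k * 1)"
    by (intro sum.mono_neutral_cong_right) auto
  also have "\<dots> = (\<Sum>a<?m. (?b ^ Suc a - ?b ^ a) / B ^ a)"
    by (subst sum_low_degree[where f = "\<lambda>a. 1 / B ^ a"]) (simp add: card_low)
  also have "\<dots> = phi_max ?b B * (1 - r)"
    unfolding r_def by (rule sum_phi_max[OF b B])
  also have "phi_max ?b B * (1 - r) + P powr lam * r \<le> B * G * (1 - r) + B * G * r"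
    using M1 M2 r by (intro add_mono mult_right_mono) auto
  also have "\<dots> = B * G" by (simp add: algebra_simps)
  finally show ?thesis by (simp add: B_def)
qed

subsection \<open>Functions with nonnegative spectrum\<close>

text \<open>The expansion is demanded for all \<open>h\<close>, which forces \<open>f\<close> to
  depend only on \<open>h mod p\<close>.\<close>

definition spectrum ::
  "'f::prime_card mod_ring poly \<Rightarrow> ('f mod_ring poly \<Rightarrow> real) \<Rightarrow> ('f mod_ring poly \<Rightarrow> real) \<Rightarrow> bool" where
  "spectrum p f g \<longleftrightarrow> (\<forall>k. g k \<ge> 0) \<and>
     (\<forall>h. complex_of_real (f h)
       = (\<Sum>k\<in>low (Polynomial.degree p). complex_of_real (g k) * char_mod p (k * h)))"

text \<open>A bound for the Fourier coefficients in the \<open>lam\<close>-th power analogue of the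
  Wiener algebra norm.\<close>

definition spectral_bound ::
  "'f::prime_card mod_ring poly \<Rightarrow> real \<Rightarrow> ('f mod_ring poly \<Rightarrow> real) \<Rightarrow> real \<Rightarrow> bool" where
  "spectral_bound p lam f C \<longleftrightarrow>
     (\<exists>g. spectrum p f g \<and> (\<Sum>k\<in>low (Polynomial.degree p). g k powr lam) \<le> C)"

text \<open>
  Nonnegativity of the spectrum makes this class closed under products: the spectrum of a product
  is a convolution of nonnegative terms, to which subadditivity of \<open>t \<mapsto> t powr lam\<close> applies.
\<close>

lemma spectral_bound_nonneg: "spectral_bound p lam f C \<Longrightarrow> C \<ge> 0"
  unfolding spectral_bound_def by (smt (verit) powr_ge_zero sum_nonneg)

lemma spectrum_const:
  assumes "c \<ge> 0"
  shows "spectrum p (\<lambda>_. c) (\<lambda>k. if k = 0 then c else 0)"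
proof -
  have "(\<Sum>k\<in>low (Polynomial.degree p). complex_of_real (if k = 0 then c else 0) * char_mod p (k * h))
      = (\<Sum>k\<in>{0}. complex_of_real (if k = 0 then c else 0) * char_mod p (k * h))" for h
    by (intro sum.mono_neutral_right) auto
  then show ?thesis using assms by (simp add: spectrum_def)
qed

lemma spectral_bound_const:
  fixes p :: "'f::prime_card mod_ring poly"
  assumes "c \<ge> 0"
  shows "spectral_bound p lam (\<lambda>_. c) (c powr lam)"
proof -
  \<comment> \<open>Only \<open>k = 0\<close> survives because \<open>0 powr lam\<close> is 0 for
    every \<open>lam\<close>.\<close>
  have "(\<Sum>k\<in>low (Polynomial.degree p). (if k = (0 :: 'f mod_ring poly) then c else 0) powr lam)
      = (\<Sum>k\<in>{0}. (if k = (0 :: 'f mod_ring poly) then c else 0) powr lam)"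
    by (intro sum.mono_neutral_right) auto
  then show ?thesis
    unfolding spectral_bound_def using spectrum_const[OF assms, of p]
    by (intro exI[of _ "\<lambda>k. if k = 0 then c else 0"]) simp
qed

lemma spectral_bound_add:
  assumes "spectral_bound p lam f C" "spectral_bound p lam f' C'" and lam: "0 < lam" "lam \<le> 1"
  shows "spectral_bound p lam (\<lambda>h. f h + f' h) (C + C')"
proof -
  obtain g g' where g: "spectrum p f g" "(\<Sum>k\<in>low (Polynomial.degree p). g k powr lam) \<le> C"
    and g': "spectrum p f' g'" "(\<Sum>k\<in>low (Polynomial.degree p). g' k powr lam) \<le> C'"
    using assms unfolding spectral_bound_def by blast
  have "spectrum p (\<lambda>h. f h + f' h) (\<lambda>k. g k + g' k)"
    using g(1) g'(1) by (simp add: spectrum_def sum.distrib distrib_right)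
  moreover have "(\<Sum>k\<in>low (Polynomial.degree p). (g k + g' k) powr lam)
      \<le> (\<Sum>k\<in>low (Polynomial.degree p). g k powr lam + g' k powr lam)"
    using g(1) g'(1) lam by (intro sum_mono powr_add_le) (auto simp: spectrum_def)
  ultimately show ?thesis
    unfolding spectral_bound_def using g(2) g'(2) by (auto simp: sum.distrib)
qed

lemma sum_low_sub:
  fixes F :: "'a::{comm_ring_1,finite} poly \<Rightarrow> 'b::comm_monoid_add"
  assumes "k0 \<in> low a"
  shows "(\<Sum>k\<in>low a. F (k - k0)) = (\<Sum>k\<in>low a. F k)"
proof -
  have "- k0 \<in> low a" using assms by (simp add: low_def)
  from sum_low_shift[OF this, of F] show ?thesis by simp
qed

lemma spectral_bound_mult:
  fixes p :: "'f::prime_card mod_ring poly"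
  assumes f: "spectral_bound p lam f C" and f': "spectral_bound p lam f' C'" and lam: "0 < lam" "lam \<le> 1"
  shows "spectral_bound p lam (\<lambda>h. f h * f' h) (C * C')"
proof -
  let ?L = "low (Polynomial.degree p) :: 'f mod_ring poly set"
  obtain g g' where g: "spectrum p f g" "(\<Sum>k\<in>?L. g k powr lam) \<le> C"
    and g': "spectrum p f' g'" "(\<Sum>k\<in>?L. g' k powr lam) \<le> C'"
    using assms unfolding spectral_bound_def by blast
  have pos: "g k \<ge> 0" "g' k \<ge> 0" for k using g(1) g'(1) by (auto simp: spectrum_def)
  \<comment> \<open>Convolution over the additive group of polynomials of degree below
    \<open>degree p\<close>; differences stay in it, so no reduction modulo \<open>p\<close>
    occurs.\<close>
  define c where "c j = (\<Sum>k\<in>?L. g k * g' (j - k))" for j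
  have "complex_of_real (f h * f' h) = (\<Sum>j\<in>?L. complex_of_real (c j) * char_mod p (j * h))" for h
  proof -
    have "complex_of_real (f h * f' h)
        = (\<Sum>k\<in>?L. \<Sum>l\<in>?L. complex_of_real (g k * g' l) * char_mod p ((l + k) * h))"
    proof -
      have fh: "complex_of_real (f h) = (\<Sum>k\<in>?L. complex_of_real (g k) * char_mod p (k * h))"
        and fh': "complex_of_real (f' h) = (\<Sum>k\<in>?L. complex_of_real (g' k) * char_mod p (k * h))"
        using g(1) g'(1) unfolding spectrum_def by blast+
      show ?thesis
        unfolding of_real_mult fh fh' sum_product distrib_right char_mod_add
        by (simp only: mult_ac)
    qed
    also have "\<dots> = (\<Sum>k\<in>?L. \<Sum>j\<in>?L. complex_of_real (g k * g' (j - k)) * char_mod p (j * h))"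
    proof (rule sum.cong[OF refl])
      fix k assume "k \<in> ?L"
      from sum_low_sub[OF this, of "\<lambda>l. complex_of_real (g k * g' l) * char_mod p ((l + k) * h)"]
      show "(\<Sum>l\<in>?L. complex_of_real (g k * g' l) * char_mod p ((l + k) * h))
          = (\<Sum>j\<in>?L. complex_of_real (g k * g' (j - k)) * char_mod p (j * h))"
        by simp
    qed
    also have "\<dots> = (\<Sum>j\<in>?L. complex_of_real (c j) * char_mod p (j * h))"
      by (subst sum.swap) (simp add: c_def sum_distrib_right)
    finally show ?thesis .
  qed
  then have "spectrum p (\<lambda>h. f h * f' h) c"
    using pos by (auto simp: spectrum_def c_def intro!: sum_nonneg)
  moreover have "(\<Sum>j\<in>?L. c j powr lam) \<le> C * C'"
  proof -
    have "(\<Sum>j\<in>?L. c j powr lam) \<le> (\<Sum>j\<in>?L. \<Sum>k\<in>?L. (g k * g' (j - k)) powr lam)"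
      unfolding c_def using pos lam by (intro sum_mono powr_sum_le) auto
    also have "\<dots> = (\<Sum>k\<in>?L. g k powr lam * (\<Sum>j\<in>?L. g' (j - k) powr lam))"
      by (subst sum.swap) (simp add: powr_mult sum_distrib_left)
    also have "\<dots> = (\<Sum>k\<in>?L. g k powr lam * (\<Sum>j\<in>?L. g' j powr lam))"
      by (intro sum.cong refl arg_cong2[of _ _ _ _ "(*)"] sum_low_sub[where F = "\<lambda>j. g' j powr lam"])
    also have "\<dots> = (\<Sum>k\<in>?L. g k powr lam) * (\<Sum>j\<in>?L. g' j powr lam)"
      by (simp add: sum_distrib_right)
    also have "\<dots> \<le> C * C'"
      using g(2) g'(2) spectral_bound_nonneg[OF f] by (intro mult_mono sum_nonneg) auto
    finally show ?thesis .
  qed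
  ultimately show ?thesis unfolding spectral_bound_def by blast
qed

lemma spectral_bound_sum:
  assumes "finite A" "\<And>i. i \<in> A \<Longrightarrow> spectral_bound p lam (f i) (C i)" and lam: "0 < lam" "lam \<le> 1"
  shows "spectral_bound p lam (\<lambda>h. \<Sum>i\<in>A. f i h) (\<Sum>i\<in>A. C i)"
  using assms(1,2)
proof (induction A rule: finite_induct)
  case empty
  show ?case using spectral_bound_const[of 0 p lam] by simp
next
  case (insert x A)
  then show ?case using lam by (simp add: spectral_bound_add)
qed

lemma spectral_bound_prod:
  assumes "finite A" "\<And>i. i \<in> A \<Longrightarrow> spectral_bound p lam (f i) (C i)" and lam: "0 < lam" "lam \<le> 1"
  shows "spectral_bound p lam (\<lambda>h. \<Prod>i\<in>A. f i h) (\<Prod>i\<in>A. C i)"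
  using assms(1,2)
proof (induction A rule: finite_induct)
  case empty
  show ?case using spectral_bound_const[of 1 p lam] by simp
next
  case (insert x A)
  then show ?case using lam by (simp add: spectral_bound_mult)
qed

text \<open>Dilation pushes the spectrum forward along \<open>k \<mapsto> k * r mod p\<close>. This
  map need not be injective; coefficients in one fibre add up, and subadditivity keeps the
  bound.\<close>

lemma spectral_bound_dilate:
  fixes p r :: "'f::prime_card mod_ring poly"
  assumes f: "spectral_bound p lam f C" and p: "p \<noteq> 0" and lam: "0 < lam" "lam \<le> 1"
  shows "spectral_bound p lam (\<lambda>h. f (h * r)) C"
proof -
  let ?L = "low (Polynomial.degree p) :: 'f mod_ring poly set"
  obtain g where g: "spectrum p f g" "(\<Sum>k\<in>?L. g k powr lam) \<le> C"
    using assms unfolding spectral_bound_def by blast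
  have pos: "g k \<ge> 0" for k using g(1) by (auto simp: spectrum_def)
  define F where "F k = (k * r) mod p" for k
  have F: "F ` ?L \<subseteq> ?L" by (auto simp: F_def low_mod[OF p])
  define c where "c j = (\<Sum>k\<in>{k \<in> ?L. F k = j}. g k)" for j
  have "complex_of_real (f (h * r)) = (\<Sum>j\<in>?L. complex_of_real (c j) * char_mod p (j * h))" for h
  proof -
    have "complex_of_real (f (h * r)) = (\<Sum>k\<in>?L. complex_of_real (g k) * char_mod p (F k * h))"
    proof -
      have "char_mod p (k * (h * r)) = char_mod p (F k * h)" for k
        unfolding F_def by (rule char_mod_cong) (subst mod_mult_left_eq, simp only: mult_ac)
      then show ?thesis using g(1) by (simp add: spectrum_def)
    qed
    also have "\<dots> = (\<Sum>j\<in>?L. \<Sum>k\<in>{k \<in> ?L. F k = j}. complex_of_real (g k) * char_mod p (F k * h))"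
      by (rule sum.group[symmetric]) (use F in auto)
    also have "\<dots> = (\<Sum>j\<in>?L. complex_of_real (c j) * char_mod p (j * h))"
      by (simp add: c_def sum_distrib_right)
    finally show ?thesis .
  qed
  then have "spectrum p (\<lambda>h. f (h * r)) c"
    using pos by (auto simp: spectrum_def c_def intro!: sum_nonneg)
  moreover have "(\<Sum>j\<in>?L. c j powr lam) \<le> C"
  proof -
    have "(\<Sum>j\<in>?L. c j powr lam) \<le> (\<Sum>j\<in>?L. \<Sum>k\<in>{k \<in> ?L. F k = j}. g k powr lam)"
      unfolding c_def using pos lam by (intro sum_mono powr_sum_le) auto
    also have "\<dots> = (\<Sum>k\<in>?L. g k powr lam)"
      by (rule sum.group) (use F in auto)
    finally show ?thesis using g(2) by simp
  qed
  ultimately show ?thesis unfolding spectral_bound_def by blast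
qed

section \<open>Increments and their average over the candidates\<close>

lemma spectrum_phi:
  "1 < d \<Longrightarrow> 0 < Polynomial.degree p \<Longrightarrow>
    spectrum p (\<lambda>h. \<phi>2 CARD('f) d (pt p h)) (phi_coeff p d)"
  for p :: "'f::prime_card mod_ring poly"
  by (simp add: spectrum_def phi_coeff_nonneg phi_expansion)

text \<open>The growth of the error bound caused by a new component \<open>r\<close>, up to a power
  of \<open>b\<close>; \<open>W\<close> collects what is already fixed.\<close>

definition cbc_increment ::
  "'f::prime_card mod_ring poly \<Rightarrow> nat \<Rightarrow> ('f mod_ring poly \<Rightarrow> real) \<Rightarrow> 'f mod_ring poly \<Rightarrow> real" where
  "cbc_increment p d W r = (\<Sum>h\<in>low (Polynomial.degree p). W h * \<phi>2 CARD('f) d (pt p (h * r)))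
     / real CARD('f) ^ Polynomial.degree p"

text \<open>Parseval's identity for the product of \<open>W\<close> and the dilate of \<open>\<phi>\<close> by \<open>r\<close>.\<close>

lemma cbc_increment_eq:
  fixes p :: "'f::prime_card mod_ring poly"
  assumes d: "1 < d" and m: "0 < Polynomial.degree p" and g: "spectrum p W g"
  shows "cbc_increment p d W r = (\<Sum>k\<in>low (Polynomial.degree p). phi_coeff p d k * g (- (k * r) mod p))"
proof -
  let ?L = "low (Polynomial.degree p) :: 'f mod_ring poly set"
  let ?b = "real CARD('f) ^ Polynomial.degree p"
  have p: "p \<noteq> 0" using m by auto
  \<comment> \<open>Orthogonality selects the \<open>l\<close> with \<open>p dvd l + k * r\<close>,
    whose only representative of low degree is \<open>- (k * r) mod p\<close>.\<close>
  have orth: "(\<Sum>h\<in>?L. char_mod p ((l + k * r) * h)) = (if l = - (k * r) mod p then complex_of_real ?b else 0)"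
    if l: "l \<in> ?L" for k l
  proof -
    have "p dvd l + k * r \<longleftrightarrow> l mod p = - (k * r) mod p"
      by (metis add_uminus_conv_diff mod_eq_dvd_iff minus_minus diff_minus_eq_add)
    then show ?thesis using sum_char_mod[OF refl m, of "l + k * r"] mod_low[OF l] by simp
  qed
  have "complex_of_real (\<Sum>h\<in>?L. W h * \<phi>2 CARD('f) d (pt p (h * r)))
      = (\<Sum>h\<in>?L. (\<Sum>l\<in>?L. complex_of_real (g l) * char_mod p (l * h)) *
          (\<Sum>k\<in>?L. complex_of_real (phi_coeff p d k) * char_mod p (k * (h * r))))"
    using g spectrum_phi[OF d m] by (simp add: spectrum_def)
  also have "\<dots> = (\<Sum>h\<in>?L. \<Sum>l\<in>?L. \<Sum>k\<in>?L.
      complex_of_real (phi_coeff p d k) * complex_of_real (g l) * char_mod p ((l + k * r) * h))"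
    unfolding sum_product distrib_right char_mod_add by (simp only: mult_ac)
  also have "\<dots> = (\<Sum>l\<in>?L. \<Sum>k\<in>?L. \<Sum>h\<in>?L.
      complex_of_real (phi_coeff p d k) * complex_of_real (g l) * char_mod p ((l + k * r) * h))"
    by (rule trans[OF sum.swap sum.cong[OF refl sum.swap]])
  also have "\<dots> = (\<Sum>k\<in>?L. \<Sum>l\<in>?L. complex_of_real (phi_coeff p d k) * complex_of_real (g l) *
      (\<Sum>h\<in>?L. char_mod p ((l + k * r) * h)))"
    unfolding sum_distrib_left by (rule sum.swap)
  also have "\<dots> = (\<Sum>k\<in>?L. \<Sum>l\<in>?L. if l = - (k * r) mod p then
      complex_of_real (phi_coeff p d k) * complex_of_real (g l) * complex_of_real ?b else 0)"
    by (intro sum.cong refl) (simp add: orth)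
  also have "\<dots> = (\<Sum>k\<in>?L. complex_of_real (phi_coeff p d k) * complex_of_real (g (- (k * r) mod p)) * complex_of_real ?b)"
    by (simp only: sum.delta[OF finite_low] low_mod[OF p] if_True)
  also have "\<dots> = complex_of_real (?b * (\<Sum>k\<in>?L. phi_coeff p d k * g (- (k * r) mod p)))"
    by (simp add: sum_distrib_left mult_ac)
  finally have "(\<Sum>h\<in>?L. W h * \<phi>2 CARD('f) d (pt p (h * r))) = ?b * (\<Sum>k\<in>?L. phi_coeff p d k * g (- (k * r) mod p))"
    unfolding of_real_eq_iff .
  then show ?thesis by (simp add: cbc_increment_def)
qed

lemma cbc_increment_nonneg:
  assumes "1 < d" "0 < Polynomial.degree p" "spectral_bound p lam W C"
  shows "cbc_increment p d W r \<ge> 0"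
proof -
  obtain g where g: "spectrum p W g" using assms unfolding spectral_bound_def by blast
  then show ?thesis
    unfolding cbc_increment_eq[OF assms(1,2) g]
    by (intro sum_nonneg mult_nonneg_nonneg phi_coeff_nonneg assms) (simp add: spectrum_def)
qed

text \<open>Serves the first component, which is prescribed: a constant weight has only frequency 0,
  so the increment is explicit.\<close>

lemma cbc_increment_const:
  fixes p :: "'f::prime_card mod_ring poly"
  assumes "1 < d" "0 < Polynomial.degree p" "c \<ge> 0"
  shows "cbc_increment p d (\<lambda>_. c) 1 = c * phi_coeff p d 0"
proof -
  let ?L = "low (Polynomial.degree p) :: 'f mod_ring poly set"
  define g where "g k = (if k = 0 then c else 0)" for k :: "'f mod_ring poly"
  have g: "spectrum p (\<lambda>_. c) g" unfolding g_def by (rule spectrum_const[OF assms(3)])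
  have "cbc_increment p d (\<lambda>_. c) 1 = (\<Sum>k\<in>?L. phi_coeff p d k * g (- k))"
    unfolding cbc_increment_eq[OF assms(1,2) g] by (intro sum.cong refl) (simp add: mod_low)
  also have "\<dots> = (\<Sum>k\<in>{0}. phi_coeff p d k * g (- k))"
    by (intro sum.mono_neutral_right) (auto simp: g_def)
  finally show ?thesis by (simp add: g_def)
qed

text \<open>Irreducibility enters here: \<open>p\<close> is prime, so multiplication by
  \<open>k\<close> is injective on nonzero residues, hence bijective by finiteness.\<close>

lemma bij_betw_mult_mod:
  fixes p k :: "'f::prime_card mod_ring poly"
  assumes p: "Factorial_Ring.irreducible p" and k: "k \<in> low (Polynomial.degree p) - {0}"
  shows "bij_betw (\<lambda>r. - (k * r) mod p) (low (Polynomial.degree p) - {0}) (low (Polynomial.degree p) - {0})"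
proof -
  let ?L = "low (Polynomial.degree p) - {0} :: 'f mod_ring poly set"
  have p0: "p \<noteq> 0" using p by auto
  have prime: "prime_elem p" using p by (rule irreducible_imp_prime_elem)
  have ndvd: "\<not> p dvd f" if "f \<in> ?L" for f
    using that p0 by (auto simp: low_iff dvd_imp_degree_le dest: dvd_imp_degree_le)
  have "inj_on (\<lambda>r. - (k * r) mod p) ?L"
  proof (rule inj_onI)
    fix r r' assume r: "r \<in> ?L" "r' \<in> ?L" and eq: "- (k * r) mod p = - (k * r') mod p"
    have "p dvd - (k * r) - - (k * r')" using eq by (simp only: mod_eq_dvd_iff)
    also have "- (k * r) - - (k * r') = k * (r' - r)" by (simp add: algebra_simps)
    finally have "p dvd r' - r" using prime ndvd[OF k] by (simp add: prime_elem_dvd_mult_iff)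
    then have "r' mod p = r mod p" by (simp only: mod_eq_dvd_iff)
    then show "r = r'" using r mod_low by (metis DiffD1)
  qed
  moreover have "(\<lambda>r. - (k * r) mod p) ` ?L \<subseteq> ?L"
  proof
    fix j assume "j \<in> (\<lambda>r. - (k * r) mod p) ` ?L"
    then obtain r where r: "r \<in> ?L" "j = - (k * r) mod p" by blast
    have "\<not> p dvd - (k * r)"
      using prime ndvd[OF k] ndvd[OF r(1)] by (simp add: prime_elem_dvd_mult_iff)
    then have "j \<noteq> 0" unfolding r(2) by (simp only: dvd_eq_mod_eq_0) simp
    moreover have "j \<in> low (Polynomial.degree p)" unfolding r(2) by (rule low_mod[OF p0])
    ultimately show "j \<in> ?L" by simp
  qed
  ultimately show ?thesis
    by (intro bij_betw_imageI endo_inj_surj) auto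
qed

text \<open>After exchanging sums, each \<open>k \<noteq> 0\<close> permutes the nonzero residues,
  which decouples the two spectra. The term \<open>k = 0\<close> repeats \<open>g 0\<close> for all
  \<open>b^m - 1\<close> candidates and is absorbed by \<open>M0\<close>.\<close>

lemma sum_cbc_increment_powr_le:
  fixes p :: "'f::prime_card mod_ring poly"
  assumes d: "1 < d" and p: "Factorial_Ring.irreducible p" and m: "0 < Polynomial.degree p"
    and lam: "0 < lam" "lam \<le> 1"
    and M0: "(real CARD('f) ^ Polynomial.degree p - 1) * phi_coeff p d 0 powr lam \<le> M"
    and M: "(\<Sum>k\<in>low (Polynomial.degree p). phi_coeff p d k powr lam) \<le> M"
    and W: "spectral_bound p lam W C"
  shows "(\<Sum>r\<in>low (Polynomial.degree p) - {0}. cbc_increment p d W r powr lam) \<le> M * C"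
proof -
  let ?L = "low (Polynomial.degree p) :: 'f mod_ring poly set"
  let ?c = "phi_coeff p d"
  obtain g where g: "spectrum p W g" and C: "(\<Sum>k\<in>?L. g k powr lam) \<le> C"
    using W unfolding spectral_bound_def by blast
  have pos: "g k \<ge> 0" for k using g by (auto simp: spectrum_def)
  have "(\<Sum>r\<in>?L - {0}. cbc_increment p d W r powr lam)
      \<le> (\<Sum>r\<in>?L - {0}. \<Sum>k\<in>?L. (?c k * g (- (k * r) mod p)) powr lam)"
    unfolding cbc_increment_eq[OF d m g]
    using pos lam d by (intro sum_mono powr_sum_le) (auto simp: phi_coeff_nonneg)
  also have "\<dots> = (\<Sum>k\<in>?L. ?c k powr lam * (\<Sum>r\<in>?L - {0}. g (- (k * r) mod p) powr lam))"
    by (subst sum.swap) (simp add: powr_mult sum_distrib_left)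
  also have "\<dots> = ?c 0 powr lam * (\<Sum>r\<in>?L - {0}. g (- (0 * r) mod p) powr lam)
      + (\<Sum>k\<in>?L - {0}. ?c k powr lam * (\<Sum>r\<in>?L - {0}. g (- (k * r) mod p) powr lam))"
    by (rule sum.remove) auto
  also have "(\<Sum>r\<in>?L - {0}. g (- (0 * r) mod p) powr lam)
      = (real CARD('f) ^ Polynomial.degree p - 1) * g 0 powr lam"
    unfolding mult_zero_left minus_zero mod_0 sum_constant card_low_nonzero ..
  also have "(\<Sum>k\<in>?L - {0}. ?c k powr lam * (\<Sum>r\<in>?L - {0}. g (- (k * r) mod p) powr lam))
      = (\<Sum>k\<in>?L - {0}. ?c k powr lam * (\<Sum>r\<in>?L - {0}. g r powr lam))"
  proof (rule sum.cong[OF refl])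
    fix k assume "k \<in> ?L - {0}"
    from sum.reindex_bij_betw[OF bij_betw_mult_mod[OF p this], of "\<lambda>r. g r powr lam"]
    show "?c k powr lam * (\<Sum>r\<in>?L - {0}. g (- (k * r) mod p) powr lam)
        = ?c k powr lam * (\<Sum>r\<in>?L - {0}. g r powr lam)"
      by (rule arg_cong)
  qed
  also have "\<dots> = (\<Sum>k\<in>?L - {0}. ?c k powr lam) * (\<Sum>r\<in>?L - {0}. g r powr lam)"
    by (simp add: sum_distrib_right)
  also have "?c 0 powr lam * ((real CARD('f) ^ Polynomial.degree p - 1) * g 0 powr lam)
      + (\<Sum>k\<in>?L - {0}. ?c k powr lam) * (\<Sum>r\<in>?L - {0}. g r powr lam)
      \<le> M * g 0 powr lam + M * (\<Sum>r\<in>?L - {0}. g r powr lam)"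
  proof (intro add_mono mult_right_mono sum_nonneg)
    show "?c 0 powr lam * ((real CARD('f) ^ Polynomial.degree p - 1) * g 0 powr lam) \<le> M * g 0 powr lam"
      using mult_right_mono[OF M0, of "g 0 powr lam"] by (simp add: mult_ac)
    have "(\<Sum>k\<in>?L - {0}. ?c k powr lam) \<le> (\<Sum>k\<in>?L. ?c k powr lam)"
      by (intro sum_mono2) auto
    with M show "(\<Sum>k\<in>?L - {0}. ?c k powr lam) \<le> M" by simp
  qed auto
  also have "\<dots> = M * (\<Sum>r\<in>?L. g r powr lam)"
    by (simp add: sum.remove[of ?L 0] distrib_left)
  also have "\<dots> \<le> M * C"
    using C M by (intro mult_left_mono order_trans[OF _ M] sum_nonneg) auto
  finally show ?thesis .
qed

subsection \<open>The component-by-component construction\<close>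

text \<open>The common shape of both sides of the theorem: block terms with weights \<gamma> in the
  error bound, \<open>G d\<close> and \<open>G a\<close> with weights
  \<open>\<gamma> powr lam\<close> in its estimate.\<close>

definition weighted_sum :: "(nat set \<Rightarrow> real) \<Rightarrow> nat \<Rightarrow> (nat \<Rightarrow> real) \<Rightarrow> real \<Rightarrow> real" where
  "weighted_sum w J x y = (\<Sum>v | v \<subseteq> {1..J - 1} \<and> v \<noteq> {}. w v * (\<Prod>j\<in>v. x j))
     + (\<Sum>v | v \<subseteq> {1..J - 1}. w (v \<union> {J}) * (\<Prod>j\<in>v. x j) * y)"

lemma weighted_sum_add:
  "weighted_sum w J x (y + y') = weighted_sum w J x y + (\<Sum>v | v \<subseteq> {1..J - 1}. w (v \<union> {J}) * (\<Prod>j\<in>v. x j)) * y'"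
  by (simp add: weighted_sum_def distrib_left sum.distrib sum_distrib_right)

lemma weighted_sum_1_0: "weighted_sum w 1 x 0 = 0"
proof -
  have "{v. v \<subseteq> {1..1 - 1 :: nat} \<and> v \<noteq> {}} = {}" by auto
  then show ?thesis unfolding weighted_sum_def by (simp only: sum.empty mult_zero_right) simp
qed

text \<open>Nonempty subsets of \<open>{1..J}\<close> are split by whether they contain
  \<open>J\<close>; a completed block thus becomes an ordinary coordinate.\<close>

lemma weighted_sum_Suc_0:
  assumes "J \<ge> 1"
  shows "weighted_sum w (Suc J) x 0 = weighted_sum w J x (x J)"
proof -
  let ?P = "{v. v \<subseteq> {1..J - 1}}"
  have J: "{1..J} = insert J {1..J - 1}" using assms by auto
  have eq: "{v. v \<subseteq> {1..J} \<and> v \<noteq> {}} = {v. v \<subseteq> {1..J - 1} \<and> v \<noteq> {}} \<union> insert J ` ?P"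
  proof (intro equalityI subsetI)
    fix v assume v: "v \<in> {v. v \<subseteq> {1..J} \<and> v \<noteq> {}}"
    show "v \<in> {v. v \<subseteq> {1..J - 1} \<and> v \<noteq> {}} \<union> insert J ` ?P"
    proof (cases "J \<in> v")
      case True
      then have "v = insert J (v - {J})" "v - {J} \<in> ?P" using v J by auto
      then show ?thesis by blast
    qed (use v J in auto)
  qed (use J in auto)
  have nin: "J \<notin> v" if "v \<in> ?P" for v using that assms by auto
  have fin: "finite v" if "v \<in> ?P" for v using that finite_subset by auto
  have inj: "inj_on (insert J) ?P" using nin by (intro inj_onI) (metis insert_ident)
  have "(\<Sum>v | v \<subseteq> {1..J} \<and> v \<noteq> {}. w v * (\<Prod>j\<in>v. x j))
      = (\<Sum>v | v \<subseteq> {1..J - 1} \<and> v \<noteq> {}. w v * (\<Prod>j\<in>v. x j)) + (\<Sum>v\<in>insert J ` ?P. w v * (\<Prod>j\<in>v. x j))"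
    unfolding eq by (rule sum.union_disjoint) (use nin in auto)
  also have "(\<Sum>v\<in>insert J ` ?P. w v * (\<Prod>j\<in>v. x j)) = (\<Sum>v\<in>?P. w (insert J v) * (\<Prod>j\<in>insert J v. x j))"
    unfolding sum.reindex[OF inj] by (simp only: o_def)
  also have "\<dots> = (\<Sum>v\<in>?P. w (v \<union> {J}) * (\<Prod>j\<in>v. x j) * x J)"
    by (intro sum.cong refl) (simp add: fin nin mult_ac)
  finally show ?thesis by (simp add: weighted_sum_def)
qed

definition coord ::
  "'f::prime_card mod_ring poly \<Rightarrow> nat \<Rightarrow> (nat \<Rightarrow> 'f mod_ring poly) \<Rightarrow> nat \<Rightarrow> 'f mod_ring poly \<Rightarrow> real" where
  "coord p d q i h = \<phi>2 CARD('f) d (pt p (h * q i))"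

text \<open>The block product without the subtracted 1, so that appending a component multiplies
  it.\<close>

definition factor_prod ::
  "'f::prime_card mod_ring poly \<Rightarrow> nat \<Rightarrow> (nat \<Rightarrow> 'f mod_ring poly) \<Rightarrow> nat \<Rightarrow> nat \<Rightarrow> 'f mod_ring poly \<Rightarrow> real" where
  "factor_prod p d q j a h = (\<Prod>l = 1..a. 1 + coord p d q ((j - 1) * d + l) h / real CARD('f) ^ l)"

text \<open>
  The error bound \<open>B\<close> at \<open>\<tau> = (J - 1) * d + a\<close>. Allowing \<open>a = 0\<close>, where the value agrees with that of
  the preceding full block, makes the increments uniform across block boundaries.
\<close>

definition cbc_error ::
  "'f::prime_card mod_ring poly \<Rightarrow> nat \<Rightarrow> (nat set \<Rightarrow> real) \<Rightarrow> (nat \<Rightarrow> 'f mod_ring poly) \<Rightarrow> nat \<Rightarrow> nat \<Rightarrow> real" where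
  "cbc_error p d \<gamma> q J a = (\<Sum>h\<in>low (Polynomial.degree p).
      weighted_sum \<gamma> J (\<lambda>j. factor_prod p d q j d h - 1) (factor_prod p d q J a h - 1))
     / real CARD('f) ^ Polynomial.degree p"

text \<open>The function multiplying the next component in the error; it involves earlier components
  only.\<close>

definition cbc_weight ::
  "'f::prime_card mod_ring poly \<Rightarrow> nat \<Rightarrow> (nat set \<Rightarrow> real) \<Rightarrow> (nat \<Rightarrow> 'f mod_ring poly) \<Rightarrow> nat \<Rightarrow> nat \<Rightarrow> 'f mod_ring poly \<Rightarrow> real" where
  "cbc_weight p d \<gamma> q J a h =
     (\<Sum>v | v \<subseteq> {1..J - 1}. \<gamma> (v \<union> {J}) * (\<Prod>j\<in>v. factor_prod p d q j d h - 1)) * factor_prod p d q J a h"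

lemma block_term_eq: "block_term p d q n j a = factor_prod p d q j a (nat_poly n) - 1"
  by (simp add: block_term_def factor_prod_def coord_def lattice_pt_def pt_def laurent_mult)

lemma B2_eq_cbc_error: "B2 d \<gamma> p q \<tau> = cbc_error p d \<gamma> q (j0 d \<tau>) (d0 d \<tau>)"
  for p :: "'f::prime_card mod_ring poly"
proof -
  let ?S = "{..<CARD('f) ^ Polynomial.degree p}"
  let ?g = "\<lambda>h. weighted_sum \<gamma> (j0 d \<tau>) (\<lambda>j. factor_prod p d q j d h - 1)
    (factor_prod p d q (j0 d \<tau>) (d0 d \<tau>) h - 1)"
  have "B2 d \<gamma> p q \<tau> = (\<Sum>n\<in>?S. ?g (nat_poly n)) / real CARD('f) ^ Polynomial.degree p"
    unfolding B2_def block_term_eq weighted_sum_def sum.distrib by (simp add: add_divide_distrib)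
  also have "(\<Sum>n\<in>?S. ?g (nat_poly n)) = (\<Sum>h\<in>low (Polynomial.degree p). ?g h)"
    by (rule sum.reindex_bij_betw[OF bij_betw_nat_poly])
  finally show ?thesis by (simp add: cbc_error_def)
qed

lemma factor_prod_Suc:
  "factor_prod p d q j (Suc a) h
    = factor_prod p d q j a h + factor_prod p d q j a h * (coord p d q ((j - 1) * d + Suc a) h / real CARD('f) ^ Suc a)"
  for p :: "'f::prime_card mod_ring poly"
  by (simp add: factor_prod_def distrib_left)

lemma cbc_error_Suc:
  fixes p :: "'f::prime_card mod_ring poly"
  shows "cbc_error p d \<gamma> q J (Suc a) = cbc_error p d \<gamma> q J a
    + cbc_increment p d (cbc_weight p d \<gamma> q J a) (q ((J - 1) * d + Suc a)) / real CARD('f) ^ Suc a"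
proof -
  let ?b = "real CARD('f)" and ?m = "Polynomial.degree p" and ?\<tau> = "(J - 1) * d + Suc a"
  have "weighted_sum \<gamma> J (\<lambda>j. factor_prod p d q j d h - 1) (factor_prod p d q J (Suc a) h - 1)
      = weighted_sum \<gamma> J (\<lambda>j. factor_prod p d q j d h - 1) (factor_prod p d q J a h - 1)
        + cbc_weight p d \<gamma> q J a h * \<phi>2 CARD('f) d (pt p (h * q ?\<tau>)) / ?b ^ Suc a" for h
  proof -
    have "factor_prod p d q J (Suc a) h - 1
        = (factor_prod p d q J a h - 1) + factor_prod p d q J a h * (coord p d q ?\<tau> h / ?b ^ Suc a)"
      by (simp add: factor_prod_Suc)
    then show ?thesis
      by (simp only: weighted_sum_add) (simp add: cbc_weight_def coord_def)
  qed
  then show ?thesis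
    by (simp add: cbc_error_def cbc_increment_def sum.distrib add_divide_distrib mult.commute
        flip: sum_divide_distrib)
qed

lemma cbc_error_Suc_0: "J \<ge> 1 \<Longrightarrow> cbc_error p d \<gamma> q (Suc J) 0 = cbc_error p d \<gamma> q J d"
  by (simp add: cbc_error_def factor_prod_def[of p d q "Suc J" 0] weighted_sum_Suc_0)

lemma cbc_error_1_0: "cbc_error p d \<gamma> q 1 0 = 0"
  unfolding cbc_error_def by (simp add: factor_prod_def[of p d q _ 0] weighted_sum_1_0[simplified])

lemma factor_prod_cong:
  "(\<And>i. i \<le> (j - 1) * d + a \<Longrightarrow> q i = q' i) \<Longrightarrow> factor_prod p d q j a = factor_prod p d q' j a"
  by (auto simp: fun_eq_iff factor_prod_def coord_def intro!: prod.cong)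

lemma block_index_le:
  assumes "j \<in> {1..J - 1 :: nat}" "i \<le> (j - 1) * d + d"
  shows "i \<le> (J - 1) * d"
proof -
  have "(j - 1) * d + d = j * d" using assms by (cases j) auto
  also have "\<dots> \<le> (J - 1) * d" using assms by (intro mult_le_mono1) auto
  finally show ?thesis using assms by simp
qed

lemma factor_prod_block_cong:
  assumes "\<And>i. i \<le> (J - 1) * d + a \<Longrightarrow> q i = q' i" "j \<in> {1..J - 1}"
  shows "factor_prod p d q j d = factor_prod p d q' j d"
  using block_index_le[OF assms(2)] assms(1) by (intro factor_prod_cong) (simp add: trans_le_add1)

text \<open>With \<open>cbc_error_cong\<close> this shows that exchanging the next component changes
  the error only through the argument \<open>r\<close> of \<open>cbc_increment\<close>.\<close>

lemma cbc_weight_cong: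
  assumes "\<And>i. i \<le> (J - 1) * d + a \<Longrightarrow> q i = q' i"
  shows "cbc_weight p d \<gamma> q J a = cbc_weight p d \<gamma> q' J a"
proof
  fix h
  have "(\<Prod>j\<in>v. factor_prod p d q j d h - 1) = (\<Prod>j\<in>v. factor_prod p d q' j d h - 1)"
    if "v \<subseteq> {1..J - 1}" for v
    using that factor_prod_block_cong[of J d a q q', OF assms] by (intro prod.cong refl) (metis subsetD)
  then show "cbc_weight p d \<gamma> q J a h = cbc_weight p d \<gamma> q' J a h"
    using factor_prod_cong[of J d a q q', OF assms]
    by (simp add: cbc_weight_def)
qed

lemma cbc_error_cong:
  assumes "\<And>i. i \<le> (J - 1) * d + a \<Longrightarrow> q i = q' i"
  shows "cbc_error p d \<gamma> q J a = cbc_error p d \<gamma> q' J a"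
proof -
  have "(\<Prod>j\<in>v. factor_prod p d q j d h - 1) = (\<Prod>j\<in>v. factor_prod p d q' j d h - 1)"
    if "v \<subseteq> {1..J - 1}" for v h
    using that factor_prod_block_cong[of J d a q q', OF assms] by (intro prod.cong refl) (metis subsetD)
  then show ?thesis
    using factor_prod_cong[of J d a q q', OF assms]
    by (simp add: cbc_error_def weighted_sum_def)
qed

text \<open>With \<open>1 \<le> a\<close> the quotient exceeds \<open>J - 1\<close>, so the ceiling
  is \<open>J\<close>; \<open>a = 0\<close> would fall back to \<open>J - 1\<close>.\<close>

lemma j0_d0:
  assumes "J \<ge> 1" "1 \<le> a" "a \<le> d"
  shows "j0 d ((J - 1) * d + a) = J" "d0 d ((J - 1) * d + a) = a"
proof -
  have d: "d > 0" using assms by simp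
  have "\<lceil>real ((J - 1) * d + a) / real d\<rceil> = int J"
    by (rule ceiling_unique) (use assms d in \<open>auto simp: field_simps of_nat_diff\<close>)
  then show "j0 d ((J - 1) * d + a) = J" by (simp add: j0_def)
  then show "d0 d ((J - 1) * d + a) = a" by (simp add: d0_def)
qed

lemma insert_block_subset:
  fixes J s :: nat
  assumes "v \<subseteq> {1..J - 1}" "1 \<le> J" "J \<le> s"
  shows "v \<union> {J} \<subseteq> {1..s}"
proof -
  have "{1..J - 1} \<subseteq> {1..s}" using assms(3) by auto
  with assms(1) have "v \<subseteq> {1..s}" by (rule subset_trans)
  then show ?thesis using assms(2,3) by simp
qed

section \<open>Error bounds for fixed \<open>p\<close>, \<open>d\<close> and
  \<open>lam\<close>\<close>

locale cbc_setting =
  fixes p :: "'f::prime_card mod_ring poly" and b d \<alpha> :: nat and lam :: real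
  assumes card [simp]: "CARD('f) = b" and irr: "Factorial_Ring.irreducible p" and m: "0 < Polynomial.degree p"
    and d: "1 < d" "d \<le> \<alpha>" and lam: "1 / real d < lam" "lam \<le> 1"
begin

abbreviation "Gt \<equiv> G2_tilde b \<alpha> d lam"
abbreviation "G \<equiv> G2 b \<alpha> d lam"
abbreviation "M \<equiv> real b powr (lam * real d) * Gt"
abbreviation "u l \<equiv> real b powr (lam * (real d - real l)) * Gt"

lemma b: "real b > 1"
  using real_CARD_gt_1[where 'f = 'f] by simp

lemma lam': "0 < lam" "1 < lam * real d"
proof -
  have "0 < 1 / real d" using d by simp
  then show "0 < lam" using lam by linarith
  show "1 < lam * real d" using lam d by (simp add: divide_simps)
qed

lemma Gt:
  "((real b - 1) / (real b ^ d - real b)) powr lam \<le> Gt" "(real b - 1) / (real b powr (lam * real d) - real b) \<le> Gt"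
  using d by (auto simp: G2_tilde_def)

lemma sum_coeff: "(\<Sum>k\<in>low (Polynomial.degree p). phi_coeff p d k powr lam) \<le> M"
  using sum_phi_coeff_powr_le[OF d(1) lam'(1) lam(2) lam'(2), where p = p and G = Gt] Gt by simp

lemma coeff_0: "(real b ^ Polynomial.degree p - 1) * phi_coeff p d 0 powr lam \<le> M"
proof -
  have "real b ^ Polynomial.degree p > 1" using b m by (simp add: one_less_power)
  then show ?thesis
    using phi_coeff_0_powr_le[OF d(1) lam' m, where G = Gt] Gt(1) by (simp add: field_simps)
qed

text \<open>Dividing a component by \<open>b^l\<close> scales its bound by
  \<open>b powr (- lam * l)\<close>; this is the origin of the exponent in
  \<open>G2\<close>.\<close>

lemma M_u: "(1 / real b ^ l) powr lam * M = u l"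
proof -
  have "(1 / real b ^ l) powr lam = real b powr (- (lam * real l))"
    using b by (simp add: powr_divide powr_minus_divide powr_powr mult.commute flip: powr_realpow)
  then have "(1 / real b ^ l) powr lam * M = (real b powr (- (lam * real l)) * real b powr (lam * real d)) * Gt"
    by simp
  also have "real b powr (- (lam * real l)) * real b powr (lam * real d) = real b powr (lam * (real d - real l))"
    by (simp add: algebra_simps flip: powr_add)
  finally show ?thesis .
qed

lemma spectral_bound_coord: "spectral_bound p lam (\<lambda>h. coord p d q i h / real b ^ l) (u l)"
proof -
  have "spectral_bound p lam (\<lambda>h. \<phi>2 b d (pt p h)) M"
    unfolding spectral_bound_def using spectrum_phi[OF d(1) m] sum_coeff by auto
  then have "spectral_bound p lam (coord p d q i) M"
    unfolding coord_def card using m lam lam' by (intro spectral_bound_dilate) auto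
  from spectral_bound_mult[OF spectral_bound_const[of "1 / real b ^ l"] this lam'(1) lam(2)]
  show ?thesis unfolding M_u by simp
qed

lemma spectral_bound_factor_prod:
  "spectral_bound p lam (factor_prod p d q j a) (\<Prod>l = 1..a. 1 + u l)"
proof -
  have "spectral_bound p lam (\<lambda>h. 1 + coord p d q i h / real b ^ l) (1 + u l)" for i l
    using spectral_bound_add[OF spectral_bound_const[of 1] spectral_bound_coord lam'(1) lam(2)] by simp
  then show ?thesis
    unfolding factor_prod_def card by (intro spectral_bound_prod lam lam') auto
qed

lemma G_Suc: "G (Suc a) = G a + (\<Prod>l = 1..a. 1 + u l) * u (Suc a)"
  by (simp add: G2_def distrib_left)

lemma G_0 [simp]: "G 0 = 0"
  by (simp add: G2_def)

text \<open>Subtraction may destroy nonnegative spectra. The 1 is therefore removed by telescoping: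
  start from 0 and add the increments of the product.\<close>

lemma spectral_bound_block: "spectral_bound p lam (\<lambda>h. factor_prod p d q j a h - 1) (G a)"
proof (induction a)
  case 0
  show ?case using spectral_bound_const[of 0 p lam] by (simp add: factor_prod_def)
next
  case (Suc a)
  have "spectral_bound p lam (\<lambda>h. factor_prod p d q j a h * (coord p d q ((j - 1) * d + Suc a) h / real b ^ Suc a))
      ((\<Prod>l = 1..a. 1 + u l) * u (Suc a))"
    by (intro spectral_bound_mult spectral_bound_factor_prod spectral_bound_coord lam lam')
  from spectral_bound_add[OF Suc this lam'(1) lam(2)]
  show ?case by (simp add: factor_prod_Suc G_Suc algebra_simps)
qed

abbreviation "weight_bound \<gamma> J a \<equiv>
  (\<Sum>v | v \<subseteq> {1..J - 1}. \<gamma> (v \<union> {J}) powr lam * (\<Prod>j\<in>v. G d)) * (\<Prod>l = 1..a. 1 + u l)"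

lemma spectral_bound_cbc_weight:
  assumes "\<And>v. v \<subseteq> {1..J - 1} \<Longrightarrow> \<gamma> (v \<union> {J}) \<ge> 0"
  shows "spectral_bound p lam (cbc_weight p d \<gamma> q J a) (weight_bound \<gamma> J a)"
proof -
  have "spectral_bound p lam (\<lambda>h. \<Prod>j\<in>v. factor_prod p d q j d h - 1) (\<Prod>j\<in>v. G d)"
    if "v \<subseteq> {1..J - 1}" for v
    using finite_subset[OF that] by (intro spectral_bound_prod spectral_bound_block lam lam') auto
  then show ?thesis
    unfolding cbc_weight_def using assms
    by (intro spectral_bound_mult spectral_bound_sum spectral_bound_const spectral_bound_factor_prod lam lam') auto
qed

text \<open>A minimizer is at most every candidate, so \<open>b^m - 1\<close> copies of its
  \<open>lam\<close>-th power are bounded by the sum over all candidates.\<close>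

lemma cbc_increment_minimal_le:
  assumes \<gamma>: "\<And>v. v \<subseteq> {1..s} \<Longrightarrow> \<gamma> v \<ge> 0" and J: "1 \<le> J" "J \<le> s" and a: "a < d"
    and cbc: "cbc_output s (Polynomial.degree p) d \<gamma> p q"
  shows "(real b ^ Polynomial.degree p - 1)
      * cbc_increment p d (cbc_weight p d \<gamma> q J a) (q ((J - 1) * d + Suc a)) powr lam
    \<le> M * weight_bound \<gamma> J a"
\<comment> \<open>This case is the first component, where \<open>q 1 = 1\<close> is prescribed
  rather than minimal.\<close>
proof (cases "J = 1 \<and> a = 0")
  case True
  have "cbc_weight p d \<gamma> q J a = (\<lambda>_. \<gamma> {1})"
    using True by (auto simp: cbc_weight_def factor_prod_def fun_eq_iff)
  moreover have "\<gamma> {1} \<ge> 0" using \<gamma>[of "{1}"] J by auto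
  moreover have "q 1 = 1" using cbc by (simp add: cbc_output_def)
  ultimately have "cbc_increment p d (cbc_weight p d \<gamma> q J a) (q ((J - 1) * d + Suc a)) = \<gamma> {1} * phi_coeff p d 0"
    using True cbc_increment_const[OF d(1) m, of "\<gamma> {1}"] by simp
  then have "(real b ^ Polynomial.degree p - 1)
      * cbc_increment p d (cbc_weight p d \<gamma> q J a) (q ((J - 1) * d + Suc a)) powr lam
      = ((real b ^ Polynomial.degree p - 1) * phi_coeff p d 0 powr lam) * \<gamma> {1} powr lam"
    by (simp add: powr_mult)
  also have "\<dots> \<le> M * \<gamma> {1} powr lam"
    by (intro mult_right_mono coeff_0) simp
  finally show ?thesis using True by simp
next
  case False
  let ?\<tau> = "(J - 1) * d + Suc a"
  let ?W = "cbc_weight p d \<gamma> q J a"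
  let ?L = "low (Polynomial.degree p) :: 'f mod_ring poly set"
  have \<gamma>': "\<gamma> (v \<union> {J}) \<ge> 0" if "v \<subseteq> {1..J - 1}" for v
    by (rule \<gamma>[OF insert_block_subset[OF that J]])
  note W = spectral_bound_cbc_weight[where J = J and \<gamma> = \<gamma> and q = q and a = a, OF \<gamma>']
  have le: "?\<tau> \<le> d * s"
  proof -
    have "?\<tau> \<le> (J - 1) * d + d" using a by simp
    also have "\<dots> = J * d" using J by (cases J) auto
    also have "\<dots> \<le> s * d" using J by (intro mult_le_mono1)
    finally show ?thesis by (simp add: mult.commute)
  qed
  have ge: "?\<tau> \<ge> 2"
  proof (cases "a = 0")
    case True
    then have "J - 1 \<ge> 1" using False J by simp
    then have "(J - 1) * d \<ge> 1 * d" by (rule mult_le_mono1)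
    then show ?thesis using d by linarith
  qed simp
  have min: "B2 d \<gamma> p q ?\<tau> \<le> B2 d \<gamma> p (q(?\<tau> := r)) ?\<tau>" if "r \<in> ?L - {0}" for r
    using cbc le ge that by (auto simp: cbc_output_def nonzero_polys_below_eq)
  have B2: "B2 d \<gamma> p q' ?\<tau> = cbc_error p d \<gamma> q J a + cbc_increment p d ?W (q' ?\<tau>) / real b ^ Suc a"
    if "\<And>i. i \<le> (J - 1) * d + a \<Longrightarrow> q' i = q i" for q'
  proof -
    have "cbc_error p d \<gamma> q' J a = cbc_error p d \<gamma> q J a"
      by (rule cbc_error_cong[OF that])
    moreover have "cbc_weight p d \<gamma> q' J a = ?W"
      by (rule cbc_weight_cong[OF that])
    ultimately show ?thesis
      using a J by (simp only: B2_eq_cbc_error j0_d0[of J "Suc a" d] cbc_error_Suc card)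
  qed
  \<comment> \<open>All other parts of \<open>B2\<close> are the same for every candidate, so
    minimality passes to the increment.\<close>
  have "cbc_increment p d ?W (q ?\<tau>) powr lam \<le> cbc_increment p d ?W r powr lam" if r: "r \<in> ?L - {0}" for r
  proof (rule powr_mono2)
    have "cbc_increment p d ?W (q ?\<tau>) / real b ^ Suc a \<le> cbc_increment p d ?W r / real b ^ Suc a"
      using min[OF r] B2[of q] B2[of "q(?\<tau> := r)"] by simp
    then show "cbc_increment p d ?W (q ?\<tau>) \<le> cbc_increment p d ?W r"
      using b by (simp add: divide_le_cancel)
  qed (use lam' cbc_increment_nonneg[OF d(1) m W] in auto)
  then have "(\<Sum>r\<in>?L - {0}. cbc_increment p d ?W (q ?\<tau>) powr lam) \<le> (\<Sum>r\<in>?L - {0}. cbc_increment p d ?W r powr lam)"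
    by (intro sum_mono)
  also have "\<dots> \<le> M * weight_bound \<gamma> J a"
    using sum_cbc_increment_powr_le[OF d(1) irr m lam'(1) lam(2) _ sum_coeff W] coeff_0 by simp
  finally show ?thesis
    by (simp only: sum_constant card_low_nonzero card)
qed

text \<open>Induction along the components of a block and then across blocks. Nonnegativity is
  carried along because subadditivity of powers requires it.\<close>

lemma cbc_error_bound:
  assumes \<gamma>: "\<And>v. v \<subseteq> {1..s} \<Longrightarrow> \<gamma> v \<ge> 0"
    and cbc: "cbc_output s (Polynomial.degree p) d \<gamma> p q"
    and J: "1 \<le> J" "J \<le> s" and a: "a \<le> d"
  shows "0 \<le> cbc_error p d \<gamma> q J a \<and>
    (real b ^ Polynomial.degree p - 1) * cbc_error p d \<gamma> q J a powr lam
      \<le> weighted_sum (\<lambda>v. \<gamma> v powr lam) J (\<lambda>_. G d) (G a)"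
    (is "?P J a")
proof -
  have bm: "real b ^ Polynomial.degree p - 1 \<ge> 0" using b by simp
  have step: "?P J (Suc a)" if P: "?P J a" and J: "1 \<le> J" "J \<le> s" and a: "a < d" for J a
  proof -
    let ?inc = "cbc_increment p d (cbc_weight p d \<gamma> q J a) (q ((J - 1) * d + Suc a))"
    have \<gamma>': "\<gamma> (v \<union> {J}) \<ge> 0" if "v \<subseteq> {1..J - 1}" for v
      by (rule \<gamma>[OF insert_block_subset[OF that J]])
    have inc: "?inc \<ge> 0"
      by (rule cbc_increment_nonneg[OF d(1) m spectral_bound_cbc_weight[where J = J and \<gamma> = \<gamma>, OF \<gamma>']])
    have "(real b ^ Polynomial.degree p - 1) * cbc_error p d \<gamma> q J (Suc a) powr lam
        \<le> (real b ^ Polynomial.degree p - 1) * (cbc_error p d \<gamma> q J a powr lam + (?inc / real b ^ Suc a) powr lam)"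
      unfolding cbc_error_Suc card using P inc lam lam' bm by (intro mult_left_mono powr_add_le) auto
    also have "\<dots> = (real b ^ Polynomial.degree p - 1) * cbc_error p d \<gamma> q J a powr lam
        + (1 / real b ^ Suc a) powr lam * ((real b ^ Polynomial.degree p - 1) * ?inc powr lam)"
      using powr_mult[of "1 / real b ^ Suc a" ?inc lam] by (simp add: algebra_simps)
    also have "\<dots> \<le> weighted_sum (\<lambda>v. \<gamma> v powr lam) J (\<lambda>_. G d) (G a)
        + (1 / real b ^ Suc a) powr lam * (M * weight_bound \<gamma> J a)"
      using P J a by (intro add_mono mult_left_mono cbc_increment_minimal_le[OF \<gamma> _ _ _ cbc]) auto
    \<comment> \<open>The scaled bound of the increment is precisely the growth of
      \<open>weighted_sum\<close> from \<open>G a\<close> to \<open>G (Suc a)\<close>.\<close>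
    also have "(1 / real b ^ Suc a) powr lam * (M * weight_bound \<gamma> J a) = u (Suc a) * weight_bound \<gamma> J a"
      by (subst M_u[of "Suc a", symmetric]) (simp only: mult.assoc)
    also have "weighted_sum (\<lambda>v. \<gamma> v powr lam) J (\<lambda>_. G d) (G a) + u (Suc a) * weight_bound \<gamma> J a
        = weighted_sum (\<lambda>v. \<gamma> v powr lam) J (\<lambda>_. G d) (G (Suc a))"
      unfolding G_Suc weighted_sum_add by (simp only: mult_ac)
    finally show ?thesis
      using P inc by (simp add: cbc_error_Suc)
  qed
  have block: "?P J a" if "?P J 0" "1 \<le> J" "J \<le> s" "a \<le> d" for J a
    using \<open>a \<le> d\<close>
  proof (induction a)
    case (Suc a)
    then show ?case using step[of J a] that by simp
  qed (use that in simp)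
  have "?P (Suc n) 0" if "Suc n \<le> s" for n
    using that
  proof (induction n)
    case 0
    show ?case using weighted_sum_1_0 cbc_error_1_0[of p d \<gamma> q] by simp
  next
    case (Suc n)
    then have "?P (Suc n) d" using block[of "Suc n" d] by simp
    then show ?case by (simp add: cbc_error_Suc_0 weighted_sum_Suc_0)
  qed
  from this[of "J - 1"] J have "?P J 0" by simp
  from block[OF this J a] show ?thesis .
qed

end

theorem theorem5:
  fixes b s m \<alpha> d :: nat
    and \<gamma> :: "nat set \<Rightarrow> real"
    and p :: "'f::prime_card mod_ring poly"
    and q :: "nat \<Rightarrow> 'f mod_ring poly"
  assumes b: "b = CARD('f)"
    and pos: "s \<ge> 1" "m \<ge> 1"
    and d: "1 < d" "d \<le> \<alpha>"
    and weights: "\<And>v. v \<subseteq> {1..s} \<Longrightarrow> \<gamma> v \<ge> 0"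
    and cbc: "cbc_output s m d \<gamma> p q"
  shows "\<forall>\<tau>\<in>{1..d * s}. \<forall>lam::real. 1 / real (min \<alpha> d) < lam \<and> lam \<le> 1 \<longrightarrow>
    B2 d \<gamma> p q \<tau> \<le>
      1 / (real b ^ m - 1) powr (1 / lam) *
      ((\<Sum>v | v \<subseteq> {1..j0 d \<tau> - 1} \<and> v \<noteq> {}. \<gamma> v powr lam * G2 b \<alpha> d lam d ^ card v)
       + G2 b \<alpha> d lam (d0 d \<tau>) *
         (\<Sum>v | v \<subseteq> {1..j0 d \<tau> - 1}. \<gamma> (v \<union> {j0 d \<tau>}) powr lam * G2 b \<alpha> d lam d ^ card v))
      powr (1 / lam)"
proof (intro ballI allI impI)
  fix \<tau> lam
  assume \<tau>: "\<tau> \<in> {1..d * s}" and lam: "1 / real (min \<alpha> d) < lam \<and> lam \<le> 1"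
  have deg: "Polynomial.degree p = m" and irr: "Factorial_Ring.irreducible p"
    using cbc by (auto simp: cbc_output_def)
  \<comment> \<open>As \<open>d \<le> \<alpha>\<close>, the minimum in the condition on
    \<open>lam\<close> equals \<open>d\<close>.\<close>
  interpret cbc_setting p b d \<alpha> lam
    using b irr deg pos d lam by unfold_locales (auto simp: min_absorb2)
  \<comment> \<open>Dividing \<open>\<tau> - 1\<close> instead of \<open>\<tau>\<close> puts
    \<open>a\<close> into \<open>{1..d}\<close>, in agreement with the ceiling in
    \<open>j0\<close>.\<close>
  define J where "J = (\<tau> - 1) div d + 1"
  define a where "a = (\<tau> - 1) mod d + 1"
  have a: "1 \<le> a" "a \<le> d" using d by (auto simp: a_def Suc_leI)
  have \<tau>_eq: "\<tau> = (J - 1) * d + a"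
    using \<tau> div_mult_mod_eq[of "\<tau> - 1" d] by (simp add: J_def a_def)
  have "\<tau> - 1 < s * d" using \<tau> by (auto simp: mult.commute)
  then have J: "1 \<le> J" "J \<le> s" by (auto simp: J_def Suc_leI less_mult_imp_div_less)
  have jd: "j0 d \<tau> = J" "d0 d \<tau> = a" unfolding \<tau>_eq by (rule j0_d0[OF J(1) a])+
  let ?E = "cbc_error p d \<gamma> q J a"
  define R where "R = (\<Sum>v | v \<subseteq> {1..J - 1} \<and> v \<noteq> {}. \<gamma> v powr lam * G2 b \<alpha> d lam d ^ card v)
       + G2 b \<alpha> d lam a * (\<Sum>v | v \<subseteq> {1..J - 1}. \<gamma> (v \<union> {J}) powr lam * G2 b \<alpha> d lam d ^ card v)"
  have R: "R = weighted_sum (\<lambda>v. \<gamma> v powr lam) J (\<lambda>_. G d) (G a)"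
    by (simp add: R_def weighted_sum_def sum_distrib_left mult_ac)
  have E: "0 \<le> ?E" "(real b ^ m - 1) * ?E powr lam \<le> R"
    using cbc_error_bound[OF weights _ J a(2)] cbc by (auto simp: R deg)
  have bm: "real b ^ m - 1 > 0"
    using real_CARD_gt_1[where 'f = 'f] pos by (simp add: one_less_power)
  have "?E = (?E powr lam) powr (1 / lam)"
    using E(1) lam' by (simp add: powr_powr)
  also have "\<dots> \<le> (R / (real b ^ m - 1)) powr (1 / lam)"
    using E(2) lam' bm by (intro powr_mono2) (auto simp: field_simps)
  also have "\<dots> = 1 / (real b ^ m - 1) powr (1 / lam) * R powr (1 / lam)"
    by (simp add: powr_divide)
  finally show "B2 d \<gamma> p q \<tau> \<le>
      1 / (real b ^ m - 1) powr (1 / lam) *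
      ((\<Sum>v | v \<subseteq> {1..j0 d \<tau> - 1} \<and> v \<noteq> {}. \<gamma> v powr lam * G2 b \<alpha> d lam d ^ card v)
       + G2 b \<alpha> d lam (d0 d \<tau>) *
         (\<Sum>v | v \<subseteq> {1..j0 d \<tau> - 1}. \<gamma> (v \<union> {j0 d \<tau>}) powr lam * G2 b \<alpha> d lam d ^ card v))
      powr (1 / lam)"
    unfolding B2_eq_cbc_error jd R_def .
qed

end
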